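(* Let $k\in\mathbb N$, $k>1$, and let $\beta(x):=(\beta_0,x,\beta_2,\ldots,\beta_{2k})$ be a sequence where each $\beta_i$ is a real number, $\beta_0>0$ and $x$ is a variable. Let $$\widehat\beta:=(\beta_2,\ldots,\beta_{2k-2}),\quad\widetilde\beta:=(\beta_2,\ldots,\beta_{2k}),\quad\overline\beta:=(\beta_4,\ldots,\beta_{2k-2}),\quad\breve\beta:=(\beta_4,\ldots,\beta_{2k})$$ be subsequences of $\beta(x)$, let $v:=(\beta_2\ \cdots\ \beta_{k-1})$ and $u:=(\beta_2\ \cdots\ \beta_k)$ be row vectors, and let $$\widetilde A:=\begin{pmatrix} \beta_0 & v \\ v^T & A_{\overline\beta} \end{pmatrix},\qquad\widehat A:=\begin{pmatrix} \beta_0 & u \\ u^T & A_{\breve\beta} \end{pmatrix}$$ (the objects $\overline\beta,v,\widetilde A$ are only used when $k>2$). Then the following statements are equivalent: (1) There exists $x_0\in\mathbb R$ and a representing measure for $\beta(x_0)$ supported on $\mathbb R$. (2) There exists $x_0\in\mathbb R$ and a $(\operatorname{rank}\widetilde\beta)$-atomic or a $(\operatorname{rank}\widetilde\beta+1)$-atomic representing measure for $\beta(x_0)$. (3) $A_{\beta(x)}$ is partially positive semidefinite and one of the following conditions is true: (a) either $k=2$ and $A_{\widetilde\beta}\succ0$; or $k>2$, $A_{\widetilde\beta}\succ0$ and $\widetilde A\succ0$. (b) $\operatorname{rank}A_{\widehat\beta}=\operatorname{rank}A_{\widetilde\beta}=\operatorname{rank}A_{\breve\beta}$. Moreover, if a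 representing measure exists (i.e. if (1) holds), then there does not exist a $(\operatorname{rank}\widetilde\beta)$-atomic representing measure (for $\beta(x_0)$ with any $x_0\in\mathbb R$) if and only if (b) holds and $\operatorname{rank}A_{\widehat\beta}<\operatorname{rank}\widehat A$.
   Context: $\mathbb N$ is the set of positive integers. For a sequence $\gamma=(\gamma_0,\ldots,\gamma_{2m})$ of odd length, $A_\gamma:=(\gamma_{i+j})_{i,j=0}^m$ is the corresponding $(m+1)\times(m+1)$ Hankel matrix (a subsequence is re-indexed from $0$). With columns $\mathbf v_0,\ldots,\mathbf v_m$ of $A_\gamma$, the rank of the sequence is $\operatorname{rank}\gamma:=m+1$ if $A_\gamma$ is nonsingular and $\operatorname{rank}\gamma:=\min\{i:\mathbf v_i\in\operatorname{span}\{\mathbf v_0,\ldots,\mathbf v_{i-1}\}\}$ if $A_\gamma$ is singular (the span of the empty set is $\{0\}$). This is distinguished from the matrix rank $\operatorname{rank}A_\gamma$. A representing measure (supported on $\mathbb R$) for a real sequence $(\beta_0,\ldots,\beta_{2k})$ is a positive Borel measure $\mu$ on $\mathbb R$ with $\beta_i=\int_{\mathbb R}t^i\,d\mu(t)$ for $i=0,\ldots,2k$. A measure is $m$-atomic if it is a sum of $m$ point masses with positive weights at distinct points. A partial symmetric matrix (some symmetric pairs of entries unspecified, here those containing the variable) is partially positive semidefinite if every principal submatrix all of whose entries are specified is positive semidefinite. $A\succ0$ means positive definite. *)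

theory Defs
  imports
    "Jordan_Normal_Form.DL_Rank"
    "Jordan_Normal_Form.DL_Submatrix"
    "HOL-Probability.Giry_Monad"
begin

text \<open>
  Finite sequences are lists; \<open>segment \<beta> a b\<close> is $(\beta_a, \ldots, \beta_b)$, re-indexed from 0
  (and empty if $b < a$).
\<close>

definition segment :: "(nat \<Rightarrow> 'a) \<Rightarrow> nat \<Rightarrow> nat \<Rightarrow> 'a list" where
  "segment \<beta> a b = map \<beta> [a..<Suc b]"

text \<open>
  Meant for lists of odd length $2m+1$, for which the size is $m+1$. The entries may be of any type,
  in particular options, so that partial Hankel matrices are covered.
\<close>

definition hankel_mat :: "'a list \<Rightarrow> 'a mat" where
  "hankel_mat \<gamma> = (let n = (length \<gamma> + 1) div 2 in Matrix.mat n n (\<lambda>(i, j). \<gamma> ! (i + j)))"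

abbreviation mat_rank :: "real mat \<Rightarrow> nat" where
  "mat_rank A \<equiv> vec_space.rank (dim_row A) A"

abbreviation vec_span :: "nat \<Rightarrow> real Matrix.vec set \<Rightarrow> real Matrix.vec set" where
  "vec_span n \<equiv> LinearCombinations.module.span class_ring (module_vec TYPE(real) n)"

text \<open>The rank of a sequence, which is in general not the rank of its Hankel matrix.\<close>

definition seq_rank :: "real list \<Rightarrow> nat" where
  "seq_rank \<gamma> = (let A = hankel_mat \<gamma>; n = dim_row A in
     if invertible_mat A then n
     else (LEAST i. i < n \<and> col A i \<in> vec_span n (col A ` {..<i})))"

definition pos_semidef_mat :: "real mat \<Rightarrow> bool" where
  "pos_semidef_mat A \<longleftrightarrow> square_mat A \<and> transpose_mat A = A \<and>
     (\<forall>x \<in> carrier_vec (dim_row A). 0 \<le> scalar_prod x (A *\<^sub>v x))"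

definition pos_def_mat :: "real mat \<Rightarrow> bool" where
  "pos_def_mat A \<longleftrightarrow> square_mat A \<and> transpose_mat A = A \<and>
     (\<forall>x \<in> carrier_vec (dim_row A). x \<noteq> 0\<^sub>v (dim_row A) \<longrightarrow> 0 < scalar_prod x (A *\<^sub>v x))"

text \<open>In a partial matrix, the entry \<^const>\<open>None\<close> means ``unspecified''.\<close>

definition partially_pos_semidef :: "real option mat \<Rightarrow> bool" where
  "partially_pos_semidef P \<longleftrightarrow> square_mat P \<and> transpose_mat P = P \<and>
     (\<forall>I \<subseteq> {..<dim_row P}. (\<forall>i\<in>I. \<forall>j\<in>I. P $$ (i, j) \<noteq> None) \<longrightarrow>
        pos_semidef_mat (map_mat the (submatrix P I I)))"

text \<open>The symmetric block matrix with corner $b$, first row $(b\ v)$ and lower right block $A$.\<close>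

definition bordered_mat :: "real \<Rightarrow> real list \<Rightarrow> real mat \<Rightarrow> real mat" where
  "bordered_mat b v A =
     (let r = mat_of_row (vec_of_list v)
      in four_block_mat (Matrix.mat 1 1 (\<lambda>_. b)) r (transpose_mat r) A)"

definition representing_measure :: "real measure \<Rightarrow> real list \<Rightarrow> bool" where
  "representing_measure \<mu> \<gamma> \<longleftrightarrow> sets \<mu> = sets borel \<and>
     (\<forall>i < length \<gamma>. has_bochner_integral \<mu> (\<lambda>t. t ^ i) (\<gamma> ! i))"

text \<open>Here \<^term>\<open>return borel t\<close> is the unit point mass at \<open>t\<close>.\<close>

definition atomic_measure :: "nat \<Rightarrow> real measure \<Rightarrow> bool" where
  "atomic_measure m \<mu> \<longleftrightarrow> sets \<mu> = sets borel \<and>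
     (\<exists>T w. finite T \<and> card T = m \<and> (\<forall>t\<in>T. 0 < w t) \<and>
        (\<forall>B \<in> sets borel. emeasure \<mu> B = (\<Sum>t\<in>T. ennreal (w t) * emeasure (return borel t) B)))"

end

theory Submission
  imports Defs "HOL-Computational_Algebra.Fundamental_Theorem_Algebra"
begin

text \<open>
  Write \<open>L\<close> for the moment functional on polynomials. Every specified principal submatrix is the Gram
  matrix of \<open>L (p * q)\<close> on a span of monomials, so definiteness and ranks become statements about
  polynomials with \<open>L (p\<^sup>2) = 0\<close>.

  If the matrix of the sequence shifted by two is singular, let \<open>c\<close> be a polynomial of least degree in
  its kernel. Equality of the three ranks makes the kernel stable under multiplication by \<open>t\<close> and forces
  \<open>c(0) \<noteq> 0\<close>; hence Gauss quadrature at the (real, simple, nonzero) roots of \<open>c\<close> represents the shifted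
  sequence. Dividing the weights by \<open>t\<^sup>2\<close> represents all moments but the zeroth, whose deficit is a
  nonnegative mass at \<open>0\<close>. If that matrix is definite, the free moment is moved to an end of the interval
  on which the completed matrix is semidefinite; there the kernel is spanned by one polynomial, and at
  one of the two ends it has degree \<open>k\<close>, so Gauss quadrature at its roots gives \<open>k\<close> atoms.
\<close>

section \<open>Moment functionals and Gram matrices of monomials\<close>

text \<open>The free moment enters the value of a square \<open>p * p\<close> only through the
  coefficient of t, hence only if p has both a constant and a linear term. Partial semidefiniteness
  therefore concerns two overlapping exponent sets, 1, ..., k and 0, 2, ..., k. The second is
  described by no degree bound, so spans of arbitrary sets of monomials are used. Rank equalities
  become usable because removing an exponent s from a semidefinite Gram matrix preserves its rank
  exactly when some kernel polynomial has a nonzero coefficient at s. The two equalities in (b) thus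
  supply kernel polynomials reaching the top exponent and the constant term. The same criterion at
  exponent 0 of 0, 2, ..., k decides whether the deficit at 0 vanishes, which is the rank condition
  of the last claim. In the definite case both ends of the interval might a priori give a kernel
  polynomial of degree below k; what excludes this is that t can be moved from one factor of a
  product to the other. Conversely, for a measure the null polynomials are those vanishing almost
  everywhere, a property that survives multiplication by t.\<close>

definition mom :: "(nat \<Rightarrow> real) \<Rightarrow> real poly \<Rightarrow> real" where
  "mom \<beta> p = (\<Sum>i\<le>degree p. poly.coeff p i * \<beta> i)"

lemma mom_eq:
  assumes "degree p \<le> N"
  shows "mom \<beta> p = (\<Sum>i\<le>N. poly.coeff p i * \<beta> i)"
  unfolding mom_def
  by (rule sum.mono_neutral_left) (use assms in \<open>auto simp: coeff_eq_0\<close>)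

lemma mom_0 [simp]: "mom \<beta> 0 = 0"
  by (simp add: mom_def)

lemma mom_add: "mom \<beta> (p + q) = mom \<beta> p + mom \<beta> q"
proof -
  define N where "N = max (degree p) (degree q)"
  have "degree (p + q) \<le> N" "degree p \<le> N" "degree q \<le> N"
    by (auto simp: N_def intro: degree_add_le)
  then show ?thesis
    by (simp add: mom_eq[of _ N] sum.distrib ring_distribs)
qed

lemma mom_smult: "mom \<beta> (Polynomial.smult a p) = a * mom \<beta> p"
proof -
  have "degree (Polynomial.smult a p) \<le> degree p" by simp
  then show ?thesis
    by (simp add: mom_eq[of _ "degree p"] sum_distrib_left mult.assoc)
qed

lemma mom_diff: "mom \<beta> (p - q) = mom \<beta> p - mom \<beta> q"
  using mom_add[of \<beta> p "Polynomial.smult (-1) q"] mom_smult[of \<beta> "-1" q] by simp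

lemma mom_sum: "mom \<beta> (\<Sum>i\<in>I. f i) = (\<Sum>i\<in>I. mom \<beta> (f i))"
  by (induction I rule: infinite_finite_induct) (auto simp: mom_add)

lemma mom_monom [simp]: "mom \<beta> (Polynomial.monom a n) = a * \<beta> n"
proof -
  have "mom \<beta> (Polynomial.monom a n) = (\<Sum>i\<le>n. poly.coeff (Polynomial.monom a n) i * \<beta> i)"
    by (rule mom_eq) (simp add: degree_monom_le)
  also have "\<dots> = (\<Sum>i\<le>n. if i = n then a * \<beta> n else 0)"
    by (rule sum.cong) auto
  finally show ?thesis by simp
qed

lemma mom_shift: "mom (\<lambda>i. \<beta> (i + m)) p = mom \<beta> (Polynomial.monom 1 m * p)"
proof -
  have "Polynomial.monom 1 m * p = (\<Sum>i\<le>degree p. Polynomial.monom (poly.coeff p i) (i + m))"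
    by (subst (1) poly_as_sum_of_monoms[of p, symmetric])
       (simp add: sum_distrib_left mult_monom add.commute)
  then show ?thesis by (simp only: mom_sum mom_monom) (simp add: mom_def)
qed

section \<open>Spans of monomials with prescribed exponents, and the forms on them\<close>

definition polys_on :: "nat set \<Rightarrow> real poly set" where
  "polys_on S = {p. \<forall>i. poly.coeff p i \<noteq> 0 \<longrightarrow> i \<in> S}"

lemma polys_onD: "p \<in> polys_on S \<Longrightarrow> i \<notin> S \<Longrightarrow> poly.coeff p i = 0"
  by (auto simp: polys_on_def)

lemma polys_on_0 [simp]: "0 \<in> polys_on S"
  by (simp add: polys_on_def)

lemma polys_on_add: "p \<in> polys_on S \<Longrightarrow> q \<in> polys_on S \<Longrightarrow> p + q \<in> polys_on S"
  by (simp add: polys_on_def) (metis add_0)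

lemma polys_on_diff: "p \<in> polys_on S \<Longrightarrow> q \<in> polys_on S \<Longrightarrow> p - q \<in> polys_on S"
  by (simp add: polys_on_def) (metis diff_0_right)

lemma polys_on_smult: "p \<in> polys_on S \<Longrightarrow> Polynomial.smult a p \<in> polys_on S"
  by (auto simp: polys_on_def)

lemma polys_on_monom: "n \<in> S \<Longrightarrow> Polynomial.monom a n \<in> polys_on S"
  by (auto simp: polys_on_def)

lemma polys_on_mono: "S \<subseteq> S' \<Longrightarrow> polys_on S \<subseteq> polys_on S'"
  by (auto simp: polys_on_def)

lemma polys_on_lessThan: "0 < n \<Longrightarrow> p \<in> polys_on {..<n} \<longleftrightarrow> degree p < n"
  by (auto simp: polys_on_def intro: le_less_trans[OF le_degree])
     (metis leading_coeff_0_iff degree_0)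

lemma polys_on_expand:
  assumes "p \<in> polys_on S" "finite S"
  shows "p = (\<Sum>i\<in>S. Polynomial.monom (poly.coeff p i) i)"
proof (rule poly_eqI)
  fix n
  have "poly.coeff (\<Sum>i\<in>S. Polynomial.monom (poly.coeff p i) i) n = (\<Sum>i\<in>S. if i = n then poly.coeff p n else 0)"
    by (auto simp: coeff_sum intro!: sum.cong)
  also have "\<dots> = poly.coeff p n"
    using assms by (auto simp: polys_onD)
  finally show "poly.coeff p n = poly.coeff (\<Sum>i\<in>S. Polynomial.monom (poly.coeff p i) i) n" by simp
qed

lemma mom_orthogonal:
  assumes "p \<in> polys_on S" "finite S" "\<And>i. i \<in> S \<Longrightarrow> mom \<beta> (f * Polynomial.monom 1 i) = 0"
  shows "mom \<beta> (f * p) = 0"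
proof -
  have "f * p = (\<Sum>i\<in>S. Polynomial.smult (poly.coeff p i) (f * Polynomial.monom 1 i))"
    by (subst polys_on_expand[OF assms(1,2)])
       (simp add: sum_distrib_left smult_monom flip: mult_smult_right)
  then show ?thesis using assms(3) by (simp add: mom_sum mom_smult)
qed

definition semidefinite_on :: "(nat \<Rightarrow> real) \<Rightarrow> nat set \<Rightarrow> bool" where
  "semidefinite_on \<beta> S \<longleftrightarrow> (\<forall>p\<in>polys_on S. 0 \<le> mom \<beta> (p * p))"

definition definite_on :: "(nat \<Rightarrow> real) \<Rightarrow> nat set \<Rightarrow> bool" where
  "definite_on \<beta> S \<longleftrightarrow> (\<forall>p\<in>polys_on S. p \<noteq> 0 \<longrightarrow> 0 < mom \<beta> (p * p))"

lemma semidefinite_on_mono: "semidefinite_on \<beta> S \<Longrightarrow> S' \<subseteq> S \<Longrightarrow> semidefinite_on \<beta> S'"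
  using polys_on_mono[of S' S] by (auto simp: semidefinite_on_def)

lemma definite_on_mono: "definite_on \<beta> S \<Longrightarrow> S' \<subseteq> S \<Longrightarrow> definite_on \<beta> S'"
  using polys_on_mono[of S' S] by (auto simp: definite_on_def)

lemma definite_imp_semidefinite: "definite_on \<beta> S \<Longrightarrow> semidefinite_on \<beta> S"
  unfolding semidefinite_on_def definite_on_def by (metis less_imp_le mom_0 mult_zero_left order_refl)

text \<open>The degenerate case of the Cauchy-Schwarz inequality: an isotropic vector of a
  semidefinite form lies in its radical. It lets one number, the value of the square, stand for
  membership in the kernel.\<close>

lemma semidefinite_null:
  assumes psd: "semidefinite_on \<beta> S" and p: "p \<in> polys_on S" and 0: "mom \<beta> (p * p) = 0"
    and q: "q \<in> polys_on S"
  shows "mom \<beta> (p * q) = 0"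
proof (rule ccontr)
  assume ne: "mom \<beta> (p * q) \<noteq> 0"
  define b where "b = mom \<beta> (p * q)"
  define d where "d = mom \<beta> (q * q)"
  \<comment> \<open>Along the line q + s p the square is affine in s, equal to d + 2 s b; this s
    makes it -1.\<close>
  define s where "s = - (d + 1) / (2 * b)"
  have "q + Polynomial.smult s p \<in> polys_on S"
    using p q by (intro polys_on_add polys_on_smult)
  then have "0 \<le> mom \<beta> ((q + Polynomial.smult s p) * (q + Polynomial.smult s p))"
    using psd by (auto simp: semidefinite_on_def)
  also have "(q + Polynomial.smult s p) * (q + Polynomial.smult s p) =
      q * q + Polynomial.smult (s + s) (p * q) + Polynomial.smult (s * s) (p * p)"
    by (simp add: ring_distribs smult_add_left smult_add_right mult.commute[of q p] add.assoc numeral_poly mult.commute[of s 2])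
  also have "mom \<beta> \<dots> = d + 2 * s * b"
    using 0 by (simp add: mom_add mom_smult b_def d_def)
  also have "2 * s * b = - (d + 1)" using ne by (simp add: s_def flip: b_def)
  finally show False by simp
qed

text \<open>The Gram matrix of the monomials with exponents \<open>e 0\<close>, ...,
  \<open>e (n - 1)\<close>. The enumeration is left free so that Hankel matrices, their trailing
  blocks, the bordered matrices and all specified principal submatrices are instances.\<close>

definition hmat :: "(nat \<Rightarrow> real) \<Rightarrow> (nat \<Rightarrow> nat) \<Rightarrow> nat \<Rightarrow> real mat" where
  "hmat \<beta> e n = Matrix.mat n n (\<lambda>(i, j). \<beta> (e i + e j))"

lemma hmat_carrier [simp]: "hmat \<beta> e n \<in> carrier_mat n n"
  and hmat_dim [simp]: "dim_row (hmat \<beta> e n) = n" "dim_col (hmat \<beta> e n) = n"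
  by (simp_all add: hmat_def)

definition poly_of_vec :: "(nat \<Rightarrow> nat) \<Rightarrow> nat \<Rightarrow> real Matrix.vec \<Rightarrow> real poly" where
  "poly_of_vec e n x = (\<Sum>i<n. Polynomial.monom (vec_index x i) (e i))"

lemma coeff_poly_of_vec:
  assumes "inj_on e {..<n}" "i < n"
  shows "poly.coeff (poly_of_vec e n x) (e i) = vec_index x i"
proof -
  have "poly.coeff (poly_of_vec e n x) (e i) = (\<Sum>j<n. if j = i then vec_index x i else 0)"
    unfolding poly_of_vec_def coeff_sum
    by (rule sum.cong) (use assms in \<open>auto simp: inj_on_eq_iff\<close>)
  then show ?thesis using assms(2) by simp
qed

lemma coeff_poly_of_vec_notin: "i \<notin> e ` {..<n} \<Longrightarrow> poly.coeff (poly_of_vec e n x) i = 0"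
  unfolding poly_of_vec_def coeff_sum by (rule sum.neutral) auto

lemma poly_of_vec_in: "poly_of_vec e n x \<in> polys_on (e ` {..<n})"
  unfolding polys_on_def using coeff_poly_of_vec_notin by blast

definition vec_of_poly :: "(nat \<Rightarrow> nat) \<Rightarrow> nat \<Rightarrow> real poly \<Rightarrow> real Matrix.vec" where
  "vec_of_poly e n p = Matrix.vec n (\<lambda>i. poly.coeff p (e i))"

lemma vec_of_poly_carrier [simp]: "vec_of_poly e n p \<in> carrier_vec n"
  by (simp add: vec_of_poly_def)

lemma vec_of_poly_index [simp]: "i < n \<Longrightarrow> vec_index (vec_of_poly e n p) i = poly.coeff p (e i)"
  by (simp add: vec_of_poly_def)

lemma poly_of_vec_of_poly:
  assumes "inj_on e {..<n}" "p \<in> polys_on (e ` {..<n})"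
  shows "poly_of_vec e n (vec_of_poly e n p) = p"
proof (rule poly_eqI)
  fix i
  show "poly.coeff (poly_of_vec e n (vec_of_poly e n p)) i = poly.coeff p i"
  proof (cases "i \<in> e ` {..<n}")
    case True
    then show ?thesis using assms by (auto simp: coeff_poly_of_vec)
  next
    case False
    then show ?thesis using assms by (simp add: coeff_poly_of_vec_notin polys_onD)
  qed
qed

lemma poly_of_vec_eq_0:
  assumes "inj_on e {..<n}" "x \<in> carrier_vec n"
  shows "poly_of_vec e n x = 0 \<longleftrightarrow> x = 0\<^sub>v n"
proof
  assume "poly_of_vec e n x = 0"
  then have "vec_index x i = 0" if "i < n" for i
    using coeff_poly_of_vec[OF assms(1) that, of x] by simp
  then show "x = 0\<^sub>v n" using assms(2) by (intro eq_vecI) auto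
qed (simp add: poly_of_vec_def)

lemma hmat_mult_vec_index:
  assumes "i < n" "x \<in> carrier_vec n"
  shows "vec_index (hmat \<beta> e n *\<^sub>v x) i = mom \<beta> (Polynomial.monom 1 (e i) * poly_of_vec e n x)"
proof -
  have "vec_index (hmat \<beta> e n *\<^sub>v x) i = (\<Sum>j<n. \<beta> (e i + e j) * vec_index x j)"
    using assms by (simp add: hmat_def scalar_prod_def atLeast0LessThan)
  then show ?thesis
    by (simp add: poly_of_vec_def sum_distrib_left mult_monom mom_sum mult.commute)
qed

lemma scalar_prod_hmat:
  assumes "x \<in> carrier_vec n" "y \<in> carrier_vec n"
  shows "scalar_prod x (hmat \<beta> e n *\<^sub>v y) = mom \<beta> (poly_of_vec e n x * poly_of_vec e n y)"
proof -
  have "scalar_prod x (hmat \<beta> e n *\<^sub>v y) = (\<Sum>i<n. vec_index x i * vec_index (hmat \<beta> e n *\<^sub>v y) i)"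
    by (simp add: scalar_prod_def atLeast0LessThan)
  also have "\<dots> = (\<Sum>i<n. mom \<beta> (Polynomial.monom (vec_index x i) (e i) * poly_of_vec e n y))"
    using assms(2)
    by (intro sum.cong refl)
       (simp del: index_mult_mat_vec add: hmat_mult_vec_index smult_monom flip: mom_smult mult_smult_left)
  also have "\<dots> = mom \<beta> (poly_of_vec e n x * poly_of_vec e n y)"
    by (simp add: poly_of_vec_def[of e n x] sum_distrib_right mom_sum)
  finally show ?thesis .
qed

lemma hmat_symmetric [simp]: "square_mat (hmat \<beta> e n)" "transpose_mat (hmat \<beta> e n) = hmat \<beta> e n"
  by (auto simp: hmat_def add.commute intro!: eq_matI)

lemma pos_semidef_hmat:
  assumes "inj_on e {..<n}"
  shows "pos_semidef_mat (hmat \<beta> e n) \<longleftrightarrow> semidefinite_on \<beta> (e ` {..<n})"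
proof
  assume *: "pos_semidef_mat (hmat \<beta> e n)"
  show "semidefinite_on \<beta> (e ` {..<n})"
    unfolding semidefinite_on_def
  proof
    fix p assume p: "p \<in> polys_on (e ` {..<n})"
    show "0 \<le> mom \<beta> (p * p)"
      using * scalar_prod_hmat[of "vec_of_poly e n p" n "vec_of_poly e n p" \<beta> e] poly_of_vec_of_poly[OF assms p]
      by (auto simp: pos_semidef_mat_def dest!: bspec[of _ _ "vec_of_poly e n p"])
  qed
next
  assume "semidefinite_on \<beta> (e ` {..<n})"
  then show "pos_semidef_mat (hmat \<beta> e n)"
    using poly_of_vec_in by (auto simp: pos_semidef_mat_def semidefinite_on_def scalar_prod_hmat)
qed

lemma pos_def_hmat:
  assumes "inj_on e {..<n}"
  shows "pos_def_mat (hmat \<beta> e n) \<longleftrightarrow> definite_on \<beta> (e ` {..<n})"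
proof
  assume *: "pos_def_mat (hmat \<beta> e n)"
  show "definite_on \<beta> (e ` {..<n})"
    unfolding definite_on_def
  proof (intro ballI impI)
    fix p assume p: "p \<in> polys_on (e ` {..<n})" "p \<noteq> 0"
    have "vec_of_poly e n p \<noteq> 0\<^sub>v n"
      using poly_of_vec_of_poly[OF assms p(1)] p(2) poly_of_vec_eq_0[OF assms, of "vec_of_poly e n p"] by auto
    then show "0 < mom \<beta> (p * p)"
      using * scalar_prod_hmat[of "vec_of_poly e n p" n "vec_of_poly e n p" \<beta> e] poly_of_vec_of_poly[OF assms p(1)]
      by (auto simp: pos_def_mat_def dest!: bspec[of _ _ "vec_of_poly e n p"])
  qed
next
  assume "definite_on \<beta> (e ` {..<n})"
  then show "pos_def_mat (hmat \<beta> e n)"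
    using poly_of_vec_in poly_of_vec_eq_0[OF assms]
    by (auto simp: pos_def_mat_def definite_on_def scalar_prod_hmat)
qed

text \<open>The nontrivial direction is \<open>semidefinite_null\<close> tested against each
  monomial. From here on, kernel vectors of the matrix are polynomials of zero square.\<close>

lemma hmat_kernel:
  assumes "inj_on e {..<n}" and psd: "semidefinite_on \<beta> (e ` {..<n})" and x: "x \<in> carrier_vec n"
  shows "hmat \<beta> e n *\<^sub>v x = 0\<^sub>v n \<longleftrightarrow> mom \<beta> (poly_of_vec e n x * poly_of_vec e n x) = 0"
proof
  assume "hmat \<beta> e n *\<^sub>v x = 0\<^sub>v n"
  then show "mom \<beta> (poly_of_vec e n x * poly_of_vec e n x) = 0"
    using scalar_prod_hmat[OF x x, of \<beta> e] x by simp
next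
  assume *: "mom \<beta> (poly_of_vec e n x * poly_of_vec e n x) = 0"
  show "hmat \<beta> e n *\<^sub>v x = 0\<^sub>v n"
  proof (rule eq_vecI)
    fix i assume "i < dim_vec (0\<^sub>v n :: real Matrix.vec)"
    then have i: "i < n" by simp
    have "mom \<beta> (poly_of_vec e n x * Polynomial.monom 1 (e i)) = 0"
      by (rule semidefinite_null[OF psd poly_of_vec_in *]) (use i in \<open>auto intro: polys_on_monom\<close>)
    then show "vec_index (hmat \<beta> e n *\<^sub>v x) i = vec_index (0\<^sub>v n) i"
      using i x by (simp del: index_mult_mat_vec add: hmat_mult_vec_index mult.commute)
  qed simp
qed

section \<open>Column rank\<close>

text \<open>Linear combinations of columns are the values of \<open>A\<close> on vectors supported
  on the corresponding indices. Working with index sets instead of sets of columns keeps repeated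
  columns under control and turns dependence into a statement about kernel vectors.\<close>

lemma span_cols_image:
  fixes A :: "real mat"
  assumes A: "A \<in> carrier_mat n m" and J: "J \<subseteq> {..<m}"
  shows "vec_span n (col A ` J) =
    {A *\<^sub>v x | x. x \<in> carrier_vec m \<and> (\<forall>j<m. j \<notin> J \<longrightarrow> vec_index x j = 0)}"
    (is "_ = ?V J")
proof -
  interpret vec_space "TYPE(real)" n .
  have col: "A *\<^sub>v unit_vec m j = col A j" if "j < m" for j
    using A that by (auto intro!: eq_vecI)
  have carrier: "col A ` J \<subseteq> carrier_vec n" if "J \<subseteq> {..<m}" for J
    using A by auto
  have sub: "LinearCombinations.submodule class_ring (?V J) V"
    unfolding submodule_def
  proof (intro conjI allI impI)
    show "Module.module class_ring V" by (rule module_axioms)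
    show "?V J \<subseteq> carrier V" using A by auto
    show "v \<oplus>\<^bsub>V\<^esub> w \<in> ?V J" if vw: "v \<in> ?V J" "w \<in> ?V J" for v w
    proof -
      from vw obtain x y where "x \<in> carrier_vec m" "\<forall>j<m. j \<notin> J \<longrightarrow> vec_index x j = 0" "v = A *\<^sub>v x"
        "y \<in> carrier_vec m" "\<forall>j<m. j \<notin> J \<longrightarrow> vec_index y j = 0" "w = A *\<^sub>v y" by blast
      then show ?thesis using A
        by (auto intro!: exI[of _ "x + y"] simp: mult_add_distrib_mat_vec)
    qed
    show "\<zero>\<^bsub>V\<^esub> \<in> ?V J"
      using A by (auto intro!: exI[of _ "0\<^sub>v m"] eq_vecI)
    show "c \<odot>\<^bsub>V\<^esub> v \<in> ?V J" if v: "v \<in> ?V J" for c v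
    proof -
      from v obtain x where "x \<in> carrier_vec m" "\<forall>j<m. j \<notin> J \<longrightarrow> vec_index x j = 0" "v = A *\<^sub>v x" by blast
      then show ?thesis using A
        by (auto intro!: exI[of _ "c \<cdot>\<^sub>v x"] simp: mult_mat_vec)
    qed
  qed
  have "col A ` J \<subseteq> ?V J"
  proof
    fix v assume "v \<in> col A ` J"
    then obtain j where "j \<in> J" "v = col A j" by auto
    then show "v \<in> ?V J" using col[of j] J
      by (auto intro!: exI[of _ "unit_vec m j"])
  qed
  then have "span (col A ` J) \<subseteq> ?V J"
    using span_is_subset[of "col A ` J"] sub by blast
  moreover have "?V J \<subseteq> span (col A ` J)"
  proof -
    have "finite J" using J finite_subset by blast
    then have "A *\<^sub>v x \<in> span (col A ` J)"
      if "x \<in> carrier_vec m" "\<forall>j<m. j \<notin> J \<longrightarrow> vec_index x j = 0" for x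
      using J that
    proof (induction J arbitrary: x rule: finite_induct)
      case empty
      then have "x = 0\<^sub>v m" by (intro eq_vecI) auto
      then have "A *\<^sub>v x = \<zero>\<^bsub>V\<^esub>" using A by (auto intro!: eq_vecI)
      then show ?case using span_is_submodule[of "{}"] by (simp add: submodule_def)
    next
      case (insert j J)
      define y where "y = x - vec_index x j \<cdot>\<^sub>v unit_vec m j"
      have jm: "j < m" using insert.prems by simp
      have y: "y \<in> carrier_vec m" "\<forall>i<m. i \<notin> J \<longrightarrow> vec_index y i = 0"
        using insert.prems insert.hyps jm by (auto simp: y_def)
      have "x = y + vec_index x j \<cdot>\<^sub>v unit_vec m j"
        using insert.prems by (intro eq_vecI) (auto simp: y_def)
      then have "A *\<^sub>v x = A *\<^sub>v y + vec_index x j \<cdot>\<^sub>v col A j"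
        using A y(1) jm
        by (metis col mult_add_distrib_mat_vec mult_mat_vec smult_carrier_vec unit_vec_carrier)
      moreover have "A *\<^sub>v y \<in> span (col A ` insert j J)"
        using insert.IH[OF _ y] insert.prems span_is_monotone[of "col A ` J" "col A ` insert j J"] by auto
      moreover have "col A j \<in> span (col A ` insert j J)"
        using carrier[of "insert j J"] insert.prems by (intro span_mem) auto
      ultimately show ?case
        using span_is_submodule[OF carrier[OF insert.prems(1)]] by (simp add: submodule_def)
    qed
    then show ?thesis by auto
  qed
  ultimately show ?thesis by auto
qed

text \<open>\<open>J\<close> indexes a maximal independent family of columns: no nonzero kernel
  vector lives on \<open>J\<close>, and every further index enters a kernel relation with
  \<open>J\<close>. The first condition also makes the columns distinct, so counting indices is
  counting columns.\<close>

lemma rank_eq_card: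
  fixes A :: "real mat"
  assumes A: "A \<in> carrier_mat n m" and J: "J \<subseteq> {..<m}"
    and indep: "\<And>x. x \<in> carrier_vec m \<Longrightarrow> \<forall>j<m. j \<notin> J \<longrightarrow> vec_index x j = 0 \<Longrightarrow> A *\<^sub>v x = 0\<^sub>v n \<Longrightarrow> x = 0\<^sub>v m"
    and maxl: "\<And>i. i < m \<Longrightarrow> i \<notin> J \<Longrightarrow> \<exists>x\<in>carrier_vec m.
      (\<forall>j<m. j \<notin> insert i J \<longrightarrow> vec_index x j = 0) \<and> vec_index x i \<noteq> 0 \<and> A *\<^sub>v x = 0\<^sub>v n"
  shows "vec_space.rank n A = card J"
proof -
  interpret vec_space "TYPE(real)" n .
  have carrier: "col A ` K \<subseteq> carrier_vec n" for K
    using A by auto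
  have fin: "finite J" using J finite_subset by blast
  have notin: "col A i \<notin> span (col A ` K)" if K: "K \<subseteq> J" "i \<in> J" "i \<notin> K" for K i
  proof
    assume "col A i \<in> span (col A ` K)"
    then obtain x where x: "x \<in> carrier_vec m" "\<forall>j<m. j \<notin> K \<longrightarrow> vec_index x j = 0" "A *\<^sub>v x = col A i"
      using span_cols_image[OF A, of K] K J by auto
    have i: "i < m" using that J by auto
    \<comment> \<open>If column i were a combination of columns in \<open>K\<close>, then x minus
      the i-th unit vector would be a kernel vector supported on \<open>J\<close> with entry -1 at
      i.\<close>
    have "A *\<^sub>v (x - unit_vec m i) = A *\<^sub>v x - A *\<^sub>v unit_vec m i"
      using A x by (simp add: mult_minus_distrib_mat_vec)
    also have "A *\<^sub>v unit_vec m i = col A i"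
      using A i by (auto intro!: eq_vecI)
    also have "A *\<^sub>v x - col A i = 0\<^sub>v n"
      using A by (auto simp: x(3) intro!: eq_vecI)
    finally have "x - unit_vec m i = 0\<^sub>v m"
      using x that i by (intro indep) auto
    then have "vec_index (x - unit_vec m i) i = 0" using i by simp
    then show False using x that i by auto
  qed
  have "K \<subseteq> J \<Longrightarrow> lin_indpt (col A ` K) \<and> card (col A ` K) = card K" if "finite K" for K
    using that
  proof (induction K rule: finite_induct)
    case empty
    then show ?case using finite_lin_dep[of "{}"] by auto
  next
    case (insert i K)
    then have ni: "col A i \<notin> span (col A ` K)" by (intro notin) auto
    then have ni': "col A i \<notin> col A ` K" using in_own_span[OF carrier[of K]] by auto
    have "lin_indpt (col A ` K \<union> {col A i})"
      using lin_dep_iff_in_span[of "col A ` K" "col A i"] insert ni ni' carrier[of K] carrier[of "{i}"] by auto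
    then show ?case using insert ni' by simp
  qed
  from this[OF fin] have indpt: "lin_indpt (col A ` J)" and card: "card (col A ` J) = card J"
    by auto
  have cols: "set (cols A) = col A ` {..<m}"
    using A by (auto simp: cols_def)
  have "maximal (col A ` J) (\<lambda>T. T \<subseteq> set (cols A) \<and> lin_indpt T)"
    unfolding maximal_def
  proof (intro conjI allI impI)
    show "col A ` J \<subseteq> set (cols A)" using J cols by auto
    show "lin_indpt (col A ` J)" by (rule indpt)
    fix T assume T: "col A ` J \<subseteq> T \<and> T \<subseteq> set (cols A) \<and> lin_indpt T"
    show "T = col A ` J"
    proof (rule ccontr)
      assume "T \<noteq> col A ` J"
      then obtain v where v: "v \<in> T" "v \<notin> col A ` J" using T by blast
      then have "v \<in> col A ` {..<m}" using T cols by blast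
      with v obtain i where i: "i < m" "col A i \<in> T" "col A i \<notin> col A ` J" by blast
      then have "i \<notin> J" by auto
      with maxl[OF i(1)] obtain x where x: "x \<in> carrier_vec m"
        "\<forall>j<m. j \<notin> insert i J \<longrightarrow> vec_index x j = 0" "vec_index x i \<noteq> 0" "A *\<^sub>v x = 0\<^sub>v n" by auto
      \<comment> \<open>The kernel relation solved for column i: the entry of y at i cancels, so y
        is supported on \<open>J\<close>.\<close>
      define y where "y = unit_vec m i - (1 / vec_index x i) \<cdot>\<^sub>v x"
      have y: "y \<in> carrier_vec m" "\<forall>j<m. j \<notin> J \<longrightarrow> vec_index y j = 0"
        using x i by (auto simp: y_def)
      have "A *\<^sub>v y = A *\<^sub>v unit_vec m i - (1 / vec_index x i) \<cdot>\<^sub>v (A *\<^sub>v x)"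
        using A x by (simp add: y_def mult_minus_distrib_mat_vec mult_mat_vec)
      also have "\<dots> = col A i"
        using A i by (auto simp: x(4) intro!: eq_vecI)
      finally have "col A i = A *\<^sub>v y" ..
      then have "col A i \<in> span (col A ` J)"
        unfolding span_cols_image[OF A J] using y by blast
      then have "lin_dep (col A ` J \<union> {col A i})"
        using lin_dep_iff_in_span[OF carrier indpt _ i(3)] carrier[of "{i}"] by simp
      moreover have "col A ` J \<union> {col A i} \<subseteq> T"
        using T i(2) by simp
      then have "lin_indpt (col A ` J \<union> {col A i})"
        using T subset_li_is_li by blast
      ultimately show False by blast
    qed
  qed
  from rank_card_indpt[OF A this] card show ?thesis by simp
qed

text \<open>The kernel polynomials. Asking only for a zero square makes the kernel of a principal
  submatrix visibly part of the kernel of the whole; in exchange, closure under subtraction rests on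
  semidefiniteness.\<close>

definition null_on :: "(nat \<Rightarrow> real) \<Rightarrow> nat set \<Rightarrow> real poly set" where
  "null_on \<beta> S = {p \<in> polys_on S. mom \<beta> (p * p) = 0}"

lemma null_on_mono: "S \<subseteq> S' \<Longrightarrow> null_on \<beta> S \<subseteq> null_on \<beta> S'"
  using polys_on_mono[of S S'] by (auto simp: null_on_def)

lemma null_on_smult: "p \<in> null_on \<beta> S \<Longrightarrow> Polynomial.smult a p \<in> null_on \<beta> S"
  by (simp add: null_on_def polys_on_smult mom_smult)

lemma null_on_0 [simp]: "0 \<in> null_on \<beta> S"
  by (simp add: null_on_def)

lemma null_on_diff:
  assumes "semidefinite_on \<beta> S" "p \<in> null_on \<beta> S" "q \<in> null_on \<beta> S"
  shows "p - q \<in> null_on \<beta> S"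
proof -
  have "mom \<beta> (p * q) = 0"
    using semidefinite_null[OF assms(1)] assms(2,3) by (auto simp: null_on_def)
  moreover have "(p - q) * (p - q) = (p * p + q * q) - (p * q + p * q)"
    by (simp add: algebra_simps)
  then have "mom \<beta> ((p - q) * (p - q)) = (mom \<beta> (p * p) + mom \<beta> (q * q)) - (mom \<beta> (p * q) + mom \<beta> (p * q))"
    by (simp only: mom_diff mom_add)
  ultimately show ?thesis
    using assms(2,3) by (simp add: null_on_def polys_on_diff)
qed

lemma null_on_sum_diff:
  assumes "semidefinite_on \<beta> S" "p \<in> null_on \<beta> S" "\<And>i. i \<in> I \<Longrightarrow> f i \<in> null_on \<beta> S"
  shows "p - (\<Sum>i\<in>I. f i) \<in> null_on \<beta> S"
  using assms(3)
proof (induction I rule: infinite_finite_induct)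
  case (insert i I)
  then have "(p - (\<Sum>i\<in>I. f i)) - f i \<in> null_on \<beta> S"
    by (intro null_on_diff[OF assms(1), where p = "p - (\<Sum>i\<in>I. f i)"]) auto
  moreover have "p - (\<Sum>i\<in>insert i I. f i) = (p - (\<Sum>i\<in>I. f i)) - f i"
    using insert.hyps by simp
  ultimately show ?case by (simp only:)
qed (use assms in auto)

lemma semidefinite_not_definite:
  assumes "semidefinite_on \<beta> S" "\<not> definite_on \<beta> S"
  obtains p where "p \<in> null_on \<beta> S" "p \<noteq> 0"
proof -
  from assms(2) obtain p where "p \<in> polys_on S" "p \<noteq> 0" "\<not> 0 < mom \<beta> (p * p)"
    by (auto simp: definite_on_def)
  moreover from this assms(1) have "0 \<le> mom \<beta> (p * p)" by (auto simp: semidefinite_on_def)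
  ultimately show ?thesis by (intro that[of p]) (auto simp: null_on_def)
qed

lemma definite_null: "definite_on \<beta> S \<Longrightarrow> p \<in> null_on \<beta> S \<Longrightarrow> p = 0"
  by (force simp: definite_on_def null_on_def)

lemma polys_on_remove: "p \<in> polys_on (insert s S) \<Longrightarrow> poly.coeff p s = 0 \<Longrightarrow> p \<in> polys_on S"
  by (auto simp: polys_on_def)

text \<open>The monomials in \<open>J\<close> span a complement of the kernel: the form is definite
  on their span, and every other monomial is reduced to them by a kernel polynomial.
  \<open>hmat_kernel\<close> turns these two facts into the hypotheses of
  \<open>rank_eq_card\<close>.\<close>

lemma rank_hmat:
  assumes inj: "inj_on e {..<n}" and psd: "semidefinite_on \<beta> (e ` {..<n})"
    and J: "J \<subseteq> e ` {..<n}" and def: "definite_on \<beta> J"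
    and maxl: "\<And>s. s \<in> e ` {..<n} - J \<Longrightarrow> \<exists>p\<in>null_on \<beta> (insert s J). poly.coeff p s \<noteq> 0"
  shows "mat_rank (hmat \<beta> e n) = card J"
proof -
  define I where "I = {i. i < n \<and> e i \<in> J}"
  have "e ` I = J" using J by (auto simp: I_def)
  moreover have "inj_on e I" using inj by (rule inj_on_subset) (auto simp: I_def)
  ultimately have card: "card J = card I" using card_image by blast
  have "vec_space.rank n (hmat \<beta> e n) = card I"
  proof (rule rank_eq_card[OF hmat_carrier])
    show "I \<subseteq> {..<n}" by (auto simp: I_def)
    fix x :: "real Matrix.vec" assume x: "x \<in> carrier_vec n" "\<forall>j<n. j \<notin> I \<longrightarrow> vec_index x j = 0"
      "hmat \<beta> e n *\<^sub>v x = 0\<^sub>v n"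
    have "poly_of_vec e n x \<in> polys_on J"
      unfolding polys_on_def
    proof safe
      fix i assume *: "poly.coeff (poly_of_vec e n x) i \<noteq> 0"
      then have "i \<in> e ` {..<n}" using coeff_poly_of_vec_notin by blast
      then obtain j where j: "j < n" "i = e j" by auto
      then show "i \<in> J" using * x(2) by (auto simp: coeff_poly_of_vec[OF inj] I_def)
    qed
    then have "poly_of_vec e n x \<in> null_on \<beta> J"
      using hmat_kernel[OF inj psd x(1)] x(3) by (simp add: null_on_def)
    then show "x = 0\<^sub>v n"
      using definite_null[OF def] poly_of_vec_eq_0[OF inj x(1)] by blast
  next
    fix i assume i: "i < n" "i \<notin> I"
    then obtain p where p: "p \<in> null_on \<beta> (insert (e i) J)" "poly.coeff p (e i) \<noteq> 0"
      using maxl[of "e i"] by (auto simp: I_def)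
    have pS: "p \<in> polys_on (e ` {..<n})"
      using p(1) polys_on_mono[of "insert (e i) J" "e ` {..<n}"] i J by (auto simp: null_on_def)
    show "\<exists>x\<in>carrier_vec n. (\<forall>j<n. j \<notin> insert i I \<longrightarrow> vec_index x j = 0) \<and> vec_index x i \<noteq> 0 \<and>
      hmat \<beta> e n *\<^sub>v x = 0\<^sub>v n"
    proof (rule bexI[of _ "vec_of_poly e n p"], intro conjI allI impI)
      show "vec_index (vec_of_poly e n p) j = 0" if "j < n" "j \<notin> insert i I" for j
      proof -
        have "e j \<notin> insert (e i) J" using that i inj by (auto simp: I_def inj_on_def)
        then show ?thesis using p(1) that polys_onD by (auto simp: null_on_def)
      qed
      show "vec_index (vec_of_poly e n p) i \<noteq> 0" using p i by simp
      show "hmat \<beta> e n *\<^sub>v vec_of_poly e n p = 0\<^sub>v n"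
        using hmat_kernel[OF inj psd, of "vec_of_poly e n p"] poly_of_vec_of_poly[OF inj pS] p(1)
        by (simp add: null_on_def)
    qed simp
  qed
  then show ?thesis by (simp add: card)
qed

text \<open>A definite subset of largest cardinality works: enlarging it by s creates a null
  polynomial, whose coefficient at s cannot vanish because the smaller set is definite.\<close>

lemma maximal_definite_exists:
  assumes "finite S" "semidefinite_on \<beta> S"
  obtains J where "J \<subseteq> S" "definite_on \<beta> J"
    "\<And>s. s \<in> S - J \<Longrightarrow> \<exists>p\<in>null_on \<beta> (insert s J). poly.coeff p s \<noteq> 0"
proof -
  have "definite_on \<beta> {}" by (auto simp: definite_on_def polys_on_def poly_eq_iff)
  then have "\<exists>J. (J \<subseteq> S \<and> definite_on \<beta> J) \<and> (\<forall>K. K \<subseteq> S \<and> definite_on \<beta> K \<longrightarrow> card K \<le> card J)"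
    using assms(1)
    by (intro ex_has_greatest_nat[of _ "{}" _ "card S + 1"]) (auto intro: card_mono le_imp_less_Suc)
  then obtain J where J: "J \<subseteq> S" "definite_on \<beta> J" "\<And>K. K \<subseteq> S \<Longrightarrow> definite_on \<beta> K \<Longrightarrow> card K \<le> card J"
    by blast
  show thesis
  proof (rule that[OF J(1,2)])
    fix s assume s: "s \<in> S - J"
    have "\<not> definite_on \<beta> (insert s J)"
      using J(3)[of "insert s J"] s J(1) finite_subset[OF J(1) assms(1)] by auto
    moreover have "semidefinite_on \<beta> (insert s J)"
      using semidefinite_on_mono[OF assms(2)] s J(1) by simp
    ultimately obtain p where p: "p \<in> null_on \<beta> (insert s J)" "p \<noteq> 0"
      using semidefinite_not_definite by blast
    moreover have "poly.coeff p s \<noteq> 0"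
    proof
      assume "poly.coeff p s = 0"
      then have "p \<in> null_on \<beta> J" using p by (auto simp: null_on_def intro: polys_on_remove)
      then show False using definite_null[OF J(2)] p by blast
    qed
    ultimately show "\<exists>p\<in>null_on \<beta> (insert s J). poly.coeff p s \<noteq> 0" by blast
  qed
qed

text \<open>One set \<open>J\<close>, maximal definite among the exponents other than s, computes
  both ranks: the smaller matrix has rank \<open>card J\<close>, and the larger one gains 1 unless a
  kernel polynomial eliminates s. Taking s at the top, at the bottom, or equal to 0 next to the gap
  at 1 expresses every rank condition of the theorem.\<close>

lemma rank_hmat_remove:
  assumes inj: "inj_on e {..<n}" and psd: "semidefinite_on \<beta> (e ` {..<n})"
    and inj': "inj_on e' {..<n'}" and img: "e' ` {..<n'} = e ` {..<n} - {s}" and s: "s \<in> e ` {..<n}"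
  shows "mat_rank (hmat \<beta> e n) =
    (if \<exists>p\<in>null_on \<beta> (e ` {..<n}). poly.coeff p s \<noteq> 0 then mat_rank (hmat \<beta> e' n')
     else Suc (mat_rank (hmat \<beta> e' n')))"
proof -
  define S where "S = e ` {..<n}"
  have fin: "finite S" by (simp add: S_def)
  have psdS: "semidefinite_on \<beta> S" using psd by (simp add: S_def)
  have psd': "semidefinite_on \<beta> (S - {s})" by (rule semidefinite_on_mono[OF psdS]) auto
  from fin obtain J where J: "J \<subseteq> S - {s}" "definite_on \<beta> J"
    and ex: "\<And>j. j \<in> S - {s} - J \<Longrightarrow> \<exists>p\<in>null_on \<beta> (insert j J). poly.coeff p j \<noteq> 0"
    using maximal_definite_exists[of "S - {s}" \<beta>] psd' by blast
  have rank': "mat_rank (hmat \<beta> e' n') = card J"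
    by (rule rank_hmat[OF inj']) (use J ex psd' in \<open>auto simp: img S_def\<close>)
  have finJ: "finite J" using J(1) fin finite_subset by blast
  show ?thesis
  proof (cases "\<exists>p\<in>null_on \<beta> S. poly.coeff p s \<noteq> 0")
    case True
    then obtain p where p: "p \<in> null_on \<beta> S" "poly.coeff p s \<noteq> 0" by blast
    define R where "R = S - {s} - J"
    from ex obtain y where y: "\<And>j. j \<in> R \<Longrightarrow> y j \<in> null_on \<beta> (insert j J)"
      "\<And>j. j \<in> R \<Longrightarrow> poly.coeff (y j) j \<noteq> 0"
      unfolding R_def[symmetric] by metis
    \<comment> \<open>The given p may involve exponents outside \<open>insert s J\<close>.
      Subtracting multiples of the relations \<open>y j\<close> clears them, and as no
      \<open>y j\<close> involves s, the coefficient at s survives.\<close>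
    define p' where "p' = p - (\<Sum>j\<in>R. Polynomial.smult (poly.coeff p j / poly.coeff (y j) j) (y j))"
    have yS: "y j \<in> null_on \<beta> S" if "j \<in> R" for j
      using null_on_mono[of "insert j J" S] y(1)[OF that] that J(1) by (auto simp: R_def)
    have p'S: "p' \<in> null_on \<beta> S"
      unfolding p'_def by (intro null_on_sum_diff[OF psdS p(1)] null_on_smult yS)
    have y0: "poly.coeff (y j) i = 0" if "j \<in> R" "i \<noteq> j" "i \<notin> J" for i j
      using y(1)[OF that(1)] that by (auto simp: null_on_def dest: polys_onD)
    have finR: "finite R" using fin by (simp add: R_def)
    have "poly.coeff p' i = 0" if i: "i \<in> R" for i
    proof -
      have "(\<Sum>j\<in>R. poly.coeff p j / poly.coeff (y j) j * poly.coeff (y j) i) =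
          (\<Sum>j\<in>R. if j = i then poly.coeff p i else 0)"
        using y(2) y0 i by (intro sum.cong refl) (auto simp: R_def)
      then show ?thesis using i finR by (simp add: p'_def coeff_sum)
    qed
    then have "p' \<in> null_on \<beta> (insert s J)"
      using p'S by (auto simp: null_on_def polys_on_def R_def)
    moreover have "(\<Sum>j\<in>R. poly.coeff p j / poly.coeff (y j) j * poly.coeff (y j) s) = 0"
      using y0[of _ s] J(1) by (intro sum.neutral) (auto simp: R_def)
    then have "poly.coeff p' s \<noteq> 0" using p(2) by (simp add: p'_def coeff_sum)
    ultimately have "\<exists>p\<in>null_on \<beta> (insert s J). poly.coeff p s \<noteq> 0" by blast
    then have "mat_rank (hmat \<beta> e n) = card J"
      using J ex psd by (intro rank_hmat[OF inj]) (auto simp: S_def)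
    then show ?thesis using True rank' by (simp add: S_def)
  next
    case False
    have "mat_rank (hmat \<beta> e n) = card (insert s J)"
    proof (rule rank_hmat[OF inj psd])
      show "insert s J \<subseteq> e ` {..<n}" using s J(1) by (auto simp: S_def)
      show "definite_on \<beta> (insert s J)"
      proof (rule ccontr)
        assume "\<not> definite_on \<beta> (insert s J)"
        moreover have sub: "insert s J \<subseteq> S" using s J(1) by (auto simp: S_def)
        ultimately obtain p where p: "p \<in> null_on \<beta> (insert s J)" "p \<noteq> 0"
          using semidefinite_not_definite semidefinite_on_mono[OF psdS sub] by blast
        then have "poly.coeff p s = 0" using False null_on_mono[OF sub] by blast
        then have "p \<in> null_on \<beta> J" using p by (auto simp: null_on_def intro: polys_on_remove)
        then show False using definite_null[OF J(2)] p by blast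
      qed
      fix i assume "i \<in> e ` {..<n} - insert s J"
      then show "\<exists>p\<in>null_on \<beta> (insert i (insert s J)). poly.coeff p i \<noteq> 0"
        using ex[of i] null_on_mono[of "insert i J" "insert i (insert s J)" \<beta>] by (auto simp: S_def)
    qed
    moreover have "s \<notin> J" using J(1) by auto
    ultimately show ?thesis using False rank' finJ by (simp add: S_def)
  qed
qed

section \<open>The rank of a sequence read off its kernel polynomials\<close>

lemma invertible_mat_iff_det:
  fixes A :: "real mat"
  assumes A: "A \<in> carrier_mat n n"
  shows "invertible_mat A \<longleftrightarrow> Determinant.det A \<noteq> 0"
proof
  assume "invertible_mat A"
  then obtain B where B: "A * B = 1\<^sub>m n" "B * A = 1\<^sub>m (dim_row B)"
    using A by (auto simp: invertible_mat_def inverts_mat_def)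
  have "dim_row B = n" using arg_cong[OF B(2), of dim_col] A by simp
  moreover have "dim_col B = n" using arg_cong[OF B(1), of dim_col] by simp
  ultimately have "B \<in> carrier_mat n n" by auto
  then show "Determinant.det A \<noteq> 0"
    using Determinant.det_mult[OF A, of B] B(1) by auto
next
  assume "Determinant.det A \<noteq> 0"
  then have "A \<in> Units (ring_mat TYPE(real) n undefined)"
    by (rule det_non_zero_imp_unit[OF A])
  then obtain B where "B \<in> carrier_mat n n" "A * B = 1\<^sub>m n" "B * A = 1\<^sub>m n"
    by (auto simp: Units_def ring_mat_def)
  then show "invertible_mat A"
    using A by (auto simp: invertible_mat_def inverts_mat_def)
qed

lemma seq_rank_definite:
  assumes A: "hankel_mat \<gamma>' = hmat \<gamma> id n" and def: "definite_on \<gamma> {..<n}"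
  shows "seq_rank \<gamma>' = n"
proof -
  have "Determinant.det (hmat \<gamma> id n) \<noteq> 0"
  proof
    assume "Determinant.det (hmat \<gamma> id n) = 0"
    then obtain x where x: "x \<in> carrier_vec n" "x \<noteq> 0\<^sub>v n" "hmat \<gamma> id n *\<^sub>v x = 0\<^sub>v n"
      using det_0_iff_vec_prod_zero_field[OF hmat_carrier] by blast
    have "poly_of_vec id n x \<in> null_on \<gamma> {..<n}"
      using hmat_kernel[of id n \<gamma> x] x definite_imp_semidefinite[OF def] poly_of_vec_in[of id n x]
      by (simp add: null_on_def)
    then show False using definite_null[OF def] poly_of_vec_eq_0[of id n x] x by auto
  qed
  then have "invertible_mat (hmat \<gamma> id n)"
    using invertible_mat_iff_det[OF hmat_carrier] by blast
  then show ?thesis by (simp add: seq_rank_def A)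
qed

text \<open>Column i depends on the earlier columns exactly when some kernel vector has its last
  nonzero entry at i, that is, when some kernel polynomial has degree i.\<close>

lemma seq_rank_not_definite:
  assumes A: "hankel_mat \<gamma>' = hmat \<gamma> id n" and psd: "semidefinite_on \<gamma> {..<n}"
    and ndef: "\<not> definite_on \<gamma> {..<n}"
  shows "seq_rank \<gamma>' = (LEAST i. i < n \<and> (\<exists>p\<in>null_on \<gamma> {..<n}. p \<noteq> 0 \<and> degree p = i))"
proof -
  obtain p where p: "p \<in> null_on \<gamma> {..<n}" "p \<noteq> 0"
    using semidefinite_not_definite[OF psd ndef] .
  have kernel: "hmat \<gamma> id n *\<^sub>v vec_of_poly id n p = 0\<^sub>v n" if "p \<in> null_on \<gamma> {..<n}" for p
    using hmat_kernel[of id n \<gamma> "vec_of_poly id n p"] psd that poly_of_vec_of_poly[of id n p]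
    by (simp add: null_on_def)
  have "vec_of_poly id n p \<noteq> 0\<^sub>v n"
    using p poly_of_vec_of_poly[of id n p] poly_of_vec_eq_0[of id n "vec_of_poly id n p"]
    by (auto simp: null_on_def)
  then have "Determinant.det (hmat \<gamma> id n) = 0"
    using det_0_iff_vec_prod_zero_field[OF hmat_carrier] kernel[OF p(1)] vec_of_poly_carrier by blast
  then have ninv: "\<not> invertible_mat (hmat \<gamma> id n)"
    using invertible_mat_iff_det[OF hmat_carrier] by blast
  have "col (hmat \<gamma> id n) i \<in> vec_span n (col (hmat \<gamma> id n) ` {..<i}) \<longleftrightarrow>
      (\<exists>p\<in>null_on \<gamma> {..<n}. p \<noteq> 0 \<and> degree p = i)" if i: "i < n" for i
  proof -
    let ?H = "hmat \<gamma> id n"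
    have unit: "?H *\<^sub>v unit_vec n i = col ?H i"
      using i by (auto intro!: eq_vecI)
    have span: "vec_span n (col ?H ` {..<i}) =
      {?H *\<^sub>v x | x. x \<in> carrier_vec n \<and> (\<forall>j<n. j \<notin> {..<i} \<longrightarrow> vec_index x j = 0)}"
      by (rule span_cols_image[OF hmat_carrier]) (use i in auto)
    show ?thesis
    proof
      assume "col ?H i \<in> vec_span n (col ?H ` {..<i})"
      then obtain x where x: "x \<in> carrier_vec n" "\<forall>j<n. j \<notin> {..<i} \<longrightarrow> vec_index x j = 0"
        "?H *\<^sub>v x = col ?H i" unfolding span by auto
      define y where "y = unit_vec n i - x"
      have y: "y \<in> carrier_vec n" "vec_index y i = 1" "\<forall>j<n. i < j \<longrightarrow> vec_index y j = 0"
        using x i by (auto simp: y_def)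
      have "?H *\<^sub>v y = ?H *\<^sub>v unit_vec n i - ?H *\<^sub>v x"
        using x by (simp add: y_def mult_minus_distrib_mat_vec[OF hmat_carrier])
      also have "\<dots> = 0\<^sub>v n" unfolding unit x(3) by auto
      finally have "poly_of_vec id n y \<in> null_on \<gamma> {..<n}"
        using hmat_kernel[of id n \<gamma> y] psd y poly_of_vec_in[of id n y] by (simp add: null_on_def)
      moreover have ci: "poly.coeff (poly_of_vec id n y) i = 1"
        using coeff_poly_of_vec[of id n i y] i y by simp
      moreover have "poly.coeff (poly_of_vec id n y) j = 0" if "i < j" for j
        using coeff_poly_of_vec[of id n j y] coeff_poly_of_vec_notin[of j id n y] y that by (cases "j < n") auto
      then have "degree (poly_of_vec id n y) \<le> i" by (intro degree_le) auto
      with ci have "degree (poly_of_vec id n y) = i"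
        by (metis le_antisym le_degree zero_neq_one)
      moreover have "poly_of_vec id n y \<noteq> 0" using ci by auto
      ultimately show "\<exists>p\<in>null_on \<gamma> {..<n}. p \<noteq> 0 \<and> degree p = i" by blast
    next
      assume "\<exists>p\<in>null_on \<gamma> {..<n}. p \<noteq> 0 \<and> degree p = i"
      then obtain p where p: "p \<in> null_on \<gamma> {..<n}" "p \<noteq> 0" "degree p = i" by blast
      define a where "a = poly.coeff p i"
      have a: "a \<noteq> 0" using p by (auto simp: a_def)
      define x where "x = unit_vec n i - (1 / a) \<cdot>\<^sub>v vec_of_poly id n p"
      have x: "x \<in> carrier_vec n" "\<forall>j<n. j \<notin> {..<i} \<longrightarrow> vec_index x j = 0"
        using a i p by (auto simp: x_def a_def vec_of_poly_def coeff_eq_0)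
      have "?H *\<^sub>v x = ?H *\<^sub>v unit_vec n i - ?H *\<^sub>v ((1 / a) \<cdot>\<^sub>v vec_of_poly id n p)"
        by (simp add: x_def mult_minus_distrib_mat_vec[OF hmat_carrier])
      also have "?H *\<^sub>v ((1 / a) \<cdot>\<^sub>v vec_of_poly id n p) = 0\<^sub>v n"
        unfolding mult_mat_vec[OF hmat_carrier vec_of_poly_carrier] kernel[OF p(1)]
        by (intro eq_vecI) simp_all
      also have "?H *\<^sub>v unit_vec n i - 0\<^sub>v n = col ?H i"
        unfolding unit by (auto intro!: eq_vecI)
      finally have "col ?H i = ?H *\<^sub>v x" ..
      then show "col ?H i \<in> vec_span n (col ?H ` {..<i})" unfolding span using x by blast
    qed
  qed
  then have "(\<lambda>i. i < n \<and> col (hmat \<gamma> id n) i \<in> vec_span n (col (hmat \<gamma> id n) ` {..<i})) =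
      (\<lambda>i. i < n \<and> (\<exists>p\<in>null_on \<gamma> {..<n}. p \<noteq> 0 \<and> degree p = i))"
    by (intro ext conj_cong refl)
  then show ?thesis
    unfolding seq_rank_def A Let_def hmat_dim if_not_P[OF ninv] by (rule arg_cong)
qed

section \<open>Gauss quadrature\<close>

lemma map_poly_of_real_add:
  "map_poly of_real (p + q) = map_poly of_real p + (map_poly of_real q :: 'a::real_field poly)"
  by (rule poly_eqI) (simp add: coeff_map_poly)

lemma map_poly_of_real_mult:
  "map_poly of_real (p * q) = map_poly of_real p * (map_poly of_real q :: 'a::real_field poly)"
  by (rule poly_eqI) (simp add: coeff_map_poly coeff_mult)

lemma poly_map_poly_of_real:
  "poly (map_poly of_real p) (of_real x) = (of_real (poly p x) :: 'a::real_field)"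
  by (induction p) (simp_all add: map_poly_pCons)

text \<open>A single excluded factor, (t - a)^2 + b^2, covers both obstructions to real and simple
  roots: b = 0 is a double real root, b nonzero a pair of conjugate roots.\<close>

lemma card_real_roots:
  fixes c :: "real poly"
  assumes c: "c \<noteq> 0" and nsq: "\<And>a b h. c \<noteq> ([:-a, 1:] ^ 2 + [:b ^ 2:]) * h"
  shows "card {t. poly c t = 0} = degree c"
proof -
  define T where "T = {t. poly c t = 0}"
  have fin: "finite T" unfolding T_def by (rule poly_roots_finite[OF c])
  have "K \<subseteq> T \<Longrightarrow> (\<Prod>t\<in>K. [:-t, 1:]) dvd c" if "finite K" for K
    using that
  proof (induction K rule: finite_induct)
    case (insert s K)
    from insert.IH insert.prems have "(\<Prod>t\<in>K. [:-t, 1:]) dvd c" by simp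
    then obtain h where h: "c = (\<Prod>t\<in>K. [:-t, 1:]) * h" by (rule dvdE)
    have "poly c s = 0" using insert.prems by (simp add: T_def)
    moreover have "poly (\<Prod>t\<in>K. [:-t, 1:]) s \<noteq> 0"
      using insert.hyps by (auto simp: poly_prod)
    ultimately have "poly h s = 0" by (simp add: h)
    then have "[:-s, 1:] dvd h" by (simp only: poly_eq_0_iff_dvd)
    then obtain g where g: "h = [:-s, 1:] * g" by (rule dvdE)
    have "c = (\<Prod>t\<in>insert s K. [:-t, 1:]) * g"
      unfolding h g prod.insert[OF insert.hyps] by (simp only: mult.assoc mult.left_commute)
    then show ?case by (rule dvdI)
  qed simp
  from this[OF fin subset_refl] obtain h where h: "c = (\<Prod>t\<in>T. [:-t, 1:]) * h" by (rule dvdE)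
  \<comment> \<open>A real root of the cofactor h is a root of c that has already been split off
    once, so it would be double: the case b = 0.\<close>
  have no_real: "poly h t \<noteq> 0" for t
  proof
    assume t: "poly h t = 0"
    then have "poly c t = 0" by (subst h) simp
    then have "t \<in> T" by (simp add: T_def)
    from t have "[:-t, 1:] dvd h" by (simp only: poly_eq_0_iff_dvd)
    then obtain g where hg: "h = [:-t, 1:] * g" by (rule dvdE)
    have "c = [:-t, 1:] ^ 2 * ((\<Prod>t\<in>T - {t}. [:-t, 1:]) * g)"
      unfolding h hg prod.remove[OF fin \<open>t \<in> T\<close>] power2_eq_square
      by (simp only: mult.assoc mult.left_commute)
    then show False using nsq[of t 0 "(\<Prod>t\<in>T - {t}. [:-t, 1:]) * g"] by simp
  qed
  have "degree h = 0"
  proof (rule ccontr)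
    assume "degree h \<noteq> 0"
    then have "\<not> constant (poly (map_poly of_real h :: complex poly))"
      by (simp add: constant_degree degree_map_poly)
    then obtain z where z: "poly (map_poly of_real h) z = (0 :: complex)"
      using fundamental_theorem_of_algebra by blast
    have "Im z \<noteq> 0"
    proof
      assume "Im z = 0"
      then have "z = of_real (Re z)" by (simp add: complex_eq_iff)
      then have "poly (map_poly of_real h) (of_real (Re z)) = (0 :: complex)" using z by simp
      then have "of_real (poly h (Re z)) = (0 :: complex)"
        by (simp only: poly_map_poly_of_real)
      then show False using no_real[of "Re z"] by simp
    qed
    \<comment> \<open>The real quadratic with roots z and its conjugate.\<close>
    define s where "s = [:-Re z, 1:] ^ 2 + [:(Im z) ^ 2:]"
    have s: "s = [:(Re z) ^ 2 + (Im z) ^ 2, -2 * Re z, 1:]"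
      by (simp add: s_def power2_eq_square)
    have sz: "poly (map_poly of_real s) z = (0 :: complex)"
      unfolding s by (simp add: map_poly_pCons complex_eq_iff power2_eq_square algebra_simps)
    have "s \<noteq> 0" by (simp add: s)
    \<comment> \<open>The remainder is at most linear, and a real polynomial of degree at most 1
      that vanishes at a nonreal point is zero; hence s divides h.\<close>
    have "degree (h mod s) < 2"
      using degree_mod_less[OF \<open>s \<noteq> 0\<close>, of h] by (auto simp: s)
    then obtain u v where uv: "h mod s = [:u, v:]"
      by (metis One_nat_def degree_eq_zeroE degree_pCons_eq_if less_2_cases pCons_cases pCons_0_0 nat.inject)
    have "map_poly of_real h = map_poly of_real s * map_poly of_real (h div s) + map_poly (of_real :: real \<Rightarrow> complex) (h mod s)"
      using map_poly_of_real_add[of "s * (h div s)" "h mod s", where ?'a = complex]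
        map_poly_of_real_mult[of s "h div s", where ?'a = complex]
      by (simp only: mult_div_mod_eq)
    then have "poly (map_poly of_real (h mod s)) z = (0 :: complex)"
      using z sz by simp
    then have "of_real u + z * of_real v = 0"
      by (simp add: uv map_poly_pCons)
    then have "v = 0" "u = 0" using \<open>Im z \<noteq> 0\<close> by (auto simp: complex_eq_iff)
    then have "s dvd h" using uv by (simp add: mod_eq_0_iff_dvd)
    then obtain g where "h = s * g" by (rule dvdE)
    then have "c = s * ((\<Prod>t\<in>T. [:-t, 1:]) * g)" by (simp add: h mult.left_commute)
    then show False using nsq unfolding s_def by blast
  qed
  moreover have "h \<noteq> 0" using no_real by auto
  moreover have "(\<Prod>t\<in>T. [:-t, 1:]) \<noteq> (0 :: real poly)" using fin by auto
  ultimately have "degree c = degree (\<Prod>t\<in>T. [:-t, 1 :: real:])"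
    unfolding h by (subst degree_mult_eq) auto
  also have "\<dots> = (\<Sum>t\<in>T. degree [:-t, 1 :: real:])"
    by (rule degree_prod_eq_sum_degree) auto
  finally show ?thesis by (simp add: T_def)
qed

lemma poly_eqI_roots:
  fixes p q :: "real poly"
  assumes "degree p < card T" "degree q < card T" "\<And>t. t \<in> T \<Longrightarrow> poly p t = poly q t"
  shows "p = q"
proof (rule ccontr)
  assume "p \<noteq> q"
  then have ne: "p - q \<noteq> 0" by simp
  have "card T \<le> card {t. poly (p - q) t = 0}"
    using assms(3) by (intro card_mono poly_roots_finite[OF ne]) auto
  also have "\<dots> \<le> degree (p - q)" by (rule card_poly_roots_bound[OF ne])
  also have "\<dots> < card T" using assms by (intro degree_diff_less)
  finally show False by simp
qed

text \<open>Positivity below \<open>degree c\<close> excludes a factor (t - a)^2 + b^2 of c, so the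
  roots are real and simple; the weights are the values of the functional on the Lagrange
  polynomials. The bound on \<open>2 * degree c\<close> is what keeps squares of polynomials of
  degree \<open>degree c - 1\<close> within the range of \<open>m\<close>.\<close>

lemma gauss_quadrature:
  assumes c: "c \<noteq> 0"
    and orth: "\<And>q. degree c + degree q \<le> m \<Longrightarrow> mom \<gamma> (c * q) = 0"
    and def: "\<And>p. p \<noteq> 0 \<Longrightarrow> degree p < degree c \<Longrightarrow> 0 < mom \<gamma> (p * p)"
    and m: "2 * degree c \<le> m + 2"
  obtains T w where "finite T" "card T = degree c" "\<And>t. t \<in> T \<Longrightarrow> poly c t = 0" "\<And>t. t \<in> T \<Longrightarrow> 0 < w t"
    "\<And>p. degree p \<le> m \<Longrightarrow> mom \<gamma> p = (\<Sum>t\<in>T. w t * poly p t)"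
proof -
  define T where "T = {t. poly c t = 0}"
  have fin: "finite T" unfolding T_def by (rule poly_roots_finite[OF c])
  have cardT: "card T = degree c"
    unfolding T_def
  proof (rule card_real_roots[OF c])
    fix a b h
    show "c \<noteq> ([:-a, 1:] ^ 2 + [:b ^ 2:]) * h"
    proof
      assume ch: "c = ([:-a, 1:] ^ 2 + [:b ^ 2:]) * h"
      have s: "[:-a, 1:] ^ 2 + [:b ^ 2:] = [:a ^ 2 + b ^ 2, -2 * a, 1:]"
        by (simp add: power2_eq_square)
      have h: "h \<noteq> 0" using ch c by auto
      have deg: "degree c = degree h + 2"
        using h unfolding ch s by (subst degree_mult_eq) auto
      have "mom \<gamma> (c * h) = 0" using deg m by (intro orth) simp
      \<comment> \<open>The left side is 0 by orthogonality, while the right side is a positive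
        square, of a polynomial of degree \<open>degree c - 1\<close>, plus a nonnegative
        one.\<close>
      also have "c * h = ([:-a, 1:] * h) * ([:-a, 1:] * h) + Polynomial.smult (b ^ 2) (h * h)"
      proof -
        have "(S ^ 2 + B) * h * h = S * h * (S * h) + B * (h * h)" for S B :: "real poly"
          by (simp add: power2_eq_square algebra_simps)
        from this[of "[:-a, 1:]" "[:b ^ 2:]"] show ?thesis unfolding ch by simp
      qed
      finally have "mom \<gamma> (([:-a, 1:] * h) * ([:-a, 1:] * h)) + b ^ 2 * mom \<gamma> (h * h) = 0"
        by (simp only: mom_add mom_smult)
      moreover have "degree ([:-a, 1:] * h) = Suc (degree h)"
        using h by (subst degree_mult_eq) auto
      then have "0 < mom \<gamma> (([:-a, 1:] * h) * ([:-a, 1:] * h))"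
        using deg by (intro def) (auto simp only: degree_0)
      moreover have "0 < mom \<gamma> (h * h)"
        by (rule def) (use h deg in auto)
      then have "0 \<le> b ^ 2 * mom \<gamma> (h * h)" by simp
      ultimately show False by linarith
    qed
  qed
  define l where "l t = (\<Prod>s\<in>T - {t}. Polynomial.smult (1 / (t - s)) [:-s, 1:])" for t
  have poly_l: "poly (l t) x = (\<Prod>s\<in>T - {t}. (x - s) / (t - s))" for t x
    by (simp add: l_def poly_prod diff_divide_distrib)
  have l_at: "poly (l t) s = (if s = t then 1 else 0)" if "t \<in> T" "s \<in> T" for s t
    using fin that by (auto simp: poly_l intro!: prod.neutral)
  have l_deg: "degree (l t) < card T" if "t \<in> T" for t
  proof -
    have "degree (l t) \<le> (\<Sum>s\<in>T - {t}. degree (Polynomial.smult (1 / (t - s)) [:-s, 1:]))"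
      unfolding l_def using fin by (intro degree_prod_sum_le[unfolded o_def]) auto
    also have "\<dots> \<le> (\<Sum>s\<in>T - {t}. 1)" by (intro sum_mono) (simp add: degree_smult_le[THEN order_trans])
    also have "\<dots> < card T" using card_Diff1_less[OF fin that] by simp
    finally show ?thesis .
  qed
  define w where "w t = mom \<gamma> (l t)" for t
  have quad: "mom \<gamma> p = (\<Sum>t\<in>T. w t * poly p t)" if p: "degree p \<le> m" for p
  \<comment> \<open>For constant c there are no nodes, and orthogonality says that the functional
    vanishes up to degree \<open>m\<close>. The remainder argument of the other case needs positive
    degree for the remainder to have degree below \<open>card T\<close>.\<close>
  proof (cases "degree c = 0")
    case True
    then obtain a where a: "c = [:a:]" by (auto elim: degree_eq_zeroE)
    have "T = {}" using cardT True fin by simp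
    moreover have "mom \<gamma> (c * Polynomial.smult (1 / a) p) = 0"
      using True p by (intro orth) (auto intro: degree_smult_le[THEN order_trans])
    ultimately show ?thesis using a c by (simp add: mom_smult)
  next
    case False
    \<comment> \<open>The zero quotient is set apart: its degree is 0 by convention, but
      \<open>degree c\<close> alone may exceed \<open>m\<close>.\<close>
    have "degree c + degree (p div c) \<le> m" if nz: "p div c \<noteq> 0"
    proof -
      have "degree c \<le> degree p" using nz div_poly_less[of p c] by (meson not_le)
      then have "degree (p mod c) \<le> degree p"
        using degree_mod_less[OF c, of p] by auto
      then have "degree (p - p mod c) \<le> degree p" by (intro degree_diff_le) simp_all
      moreover have "p - p mod c = c * (p div c)" by (simp add: minus_mod_eq_mult_div)
      ultimately show ?thesis using degree_mult_eq[OF c nz] p by simp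
    qed
    then have "mom \<gamma> (c * (p div c)) = 0"
      using orth[of "p div c"] by (cases "p div c = 0") auto
    moreover have "p = c * (p div c) + p mod c" by simp
    ultimately have "mom \<gamma> p = mom \<gamma> (p mod c)" by (metis add_0 mom_add)
    also have "p mod c = (\<Sum>t\<in>T. Polynomial.smult (poly p t) (l t))"
    proof (rule poly_eqI_roots)
      show "degree (p mod c) < card T"
        using degree_mod_less[OF c, of p] False by (auto simp: cardT)
      show "degree (\<Sum>t\<in>T. Polynomial.smult (poly p t) (l t)) < card T"
        using False l_deg
        by (intro degree_sum_less) (auto simp: cardT intro: degree_smult_le[THEN le_less_trans])
      fix t assume t: "t \<in> T"
      have "poly (p mod c) t = poly p t"
        using arg_cong[OF mult_div_mod_eq[of c p], of "\<lambda>q. poly q t"] t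
        by (simp only: poly_add poly_mult T_def mem_Collect_eq)
      moreover have "(\<Sum>s\<in>T. poly p s * poly (l s) t) = (\<Sum>s\<in>T. if s = t then poly p t else 0)"
        using l_at t by (intro sum.cong) auto
      ultimately show "poly (p mod c) t = poly (\<Sum>t\<in>T. Polynomial.smult (poly p t) (l t)) t"
        using t fin by (simp add: poly_sum)
    qed
    finally show ?thesis by (simp add: mom_sum mom_smult w_def mult.commute)
  qed
  have "0 < w t" if t: "t \<in> T" for t
  proof -
    have "l t \<noteq> 0" using l_at[OF t t] by auto
    then have "0 < mom \<gamma> (l t * l t)" using l_deg[OF t] by (intro def) (auto simp: cardT)
    \<comment> \<open>On the square of a Lagrange polynomial the quadrature formula leaves a single
      term, the weight itself.\<close>
    also have "mom \<gamma> (l t * l t) = (\<Sum>s\<in>T. w s * poly (l t * l t) s)"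
    proof (rule quad)
      show "degree (l t * l t) \<le> m"
        using degree_mult_le[of "l t" "l t"] l_deg[OF t] m cardT by linarith
    qed
    also have "\<dots> = (\<Sum>s\<in>T. if s = t then w t else 0)"
      using l_at[OF t] by (intro sum.cong) auto
    also have "\<dots> = w t" using t fin by simp
    finally show ?thesis .
  qed
  with fin cardT quad show thesis by (intro that[of T w]) (auto simp: T_def)
qed

section \<open>Completing the sequence\<close>

lemma shift_polys_on:
  "p \<in> polys_on {..<n - 1} \<Longrightarrow> Polynomial.monom 1 1 * p \<in> polys_on {..<n}"
  unfolding polys_on_def by (auto simp: coeff_monom_mult)

lemma mult_monom_1_coeff_0: "poly.coeff p 0 = 0 \<Longrightarrow> \<exists>q. p = Polynomial.monom 1 1 * (q :: real poly)"
  by (cases p) (auto simp: monom_altdef)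

lemma null_onI:
  "p \<in> polys_on S \<Longrightarrow> (\<And>q. q \<in> polys_on S \<Longrightarrow> mom \<gamma> (p * q) = 0) \<Longrightarrow> p \<in> null_on \<gamma> S"
  by (simp add: null_on_def)

lemma null_on_orthogonal:
  "semidefinite_on \<gamma> S \<Longrightarrow> p \<in> null_on \<gamma> S \<Longrightarrow> q \<in> polys_on S \<Longrightarrow> mom \<gamma> (p * q) = 0"
  using semidefinite_null by (auto simp: null_on_def)

text \<open>A test polynomial q with a term of exponent \<open>n - 1\<close> cannot absorb the
  factor t. Reducing it modulo f, which reaches the top exponent, removes that term; then t passes
  from p to the reduced q without leaving the space.\<close>

lemma null_on_shift:
  assumes psd: "semidefinite_on \<gamma> {..<n}" and top: "f \<in> null_on \<gamma> {..<n}" "poly.coeff f (n - 1) \<noteq> 0"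
    and p: "p \<in> null_on \<gamma> {..<n}" "p \<in> polys_on {..<n - 1}"
  shows "Polynomial.monom 1 1 * p \<in> null_on \<gamma> {..<n}"
proof (rule null_onI)
  show Xp: "Polynomial.monom 1 1 * p \<in> polys_on {..<n}" using p(2) by (rule shift_polys_on)
  fix q assume q: "q \<in> polys_on {..<n}"
  define a where "a = poly.coeff q (n - 1) / poly.coeff f (n - 1)"
  define q' where "q' = q - Polynomial.smult a f"
  have "q' \<in> polys_on {..<n}" "poly.coeff q' (n - 1) = 0"
    using q top by (auto simp: q'_def a_def null_on_def intro: polys_on_diff polys_on_smult)
  then have q': "q' \<in> polys_on {..<n - 1}"
    unfolding polys_on_def
  proof safe
    fix i assume *: "\<forall>i. poly.coeff q' i \<noteq> 0 \<longrightarrow> i \<in> {..<n}" "poly.coeff q' (n - 1) = 0" "poly.coeff q' i \<noteq> 0"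
    then have "i < n" "i \<noteq> n - 1" by auto
    then show "i < n - 1" by simp
  qed
  have "mom \<gamma> (p * (Polynomial.monom 1 1 * q')) = 0"
    by (rule null_on_orthogonal[OF psd p(1) shift_polys_on[OF q']])
  moreover have "mom \<gamma> (f * (Polynomial.monom 1 1 * p)) = 0"
    by (rule null_on_orthogonal[OF psd top(1) Xp])
  moreover have "Polynomial.monom 1 1 * p * q =
      p * (Polynomial.monom 1 1 * q') + Polynomial.smult a (f * (Polynomial.monom 1 1 * p))"
    by (simp add: q'_def algebra_simps)
  ultimately show "mom \<gamma> (Polynomial.monom 1 1 * p * q) = 0"
    by (simp only: mom_add mom_smult)
qed

text \<open>The mirror image at the bottom: modulo f, which has a nonzero constant term, a test
  polynomial becomes a multiple of t, and this t turns p into the kernel polynomial t p.\<close>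

lemma null_on_unshift:
  assumes psd: "semidefinite_on \<gamma> {..<n}" and bot: "f \<in> null_on \<gamma> {..<n}" "poly.coeff f 0 \<noteq> 0"
    and p: "Polynomial.monom 1 1 * p \<in> null_on \<gamma> {..<n}" "p \<in> polys_on {..<n}"
  shows "p \<in> null_on \<gamma> {..<n}"
proof (rule null_onI[OF p(2)])
  fix q assume q: "q \<in> polys_on {..<n}"
  define a where "a = poly.coeff q 0 / poly.coeff f 0"
  define g where "g = q - Polynomial.smult a f"
  have g: "g \<in> polys_on {..<n}" "poly.coeff g 0 = 0"
    using q bot by (auto simp: g_def a_def null_on_def intro: polys_on_diff polys_on_smult)
  then obtain h where h: "g = Polynomial.monom 1 1 * h" using mult_monom_1_coeff_0 by blast
  have "poly.coeff h i = 0" if "\<not> i < n" for i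
    using polys_onD[OF g(1), of "Suc i"] that by (simp add: h coeff_monom_mult)
  then have "h \<in> polys_on {..<n}" by (auto simp: polys_on_def)
  then have "mom \<gamma> (Polynomial.monom 1 1 * p * h) = 0"
    by (rule null_on_orthogonal[OF psd p(1)])
  moreover have "mom \<gamma> (f * p) = 0" by (rule null_on_orthogonal[OF psd bot(1) p(2)])
  moreover have "p * q = Polynomial.monom 1 1 * p * h + Polynomial.smult a (f * p)"
  proof -
    have "q = Polynomial.monom 1 1 * h + Polynomial.smult a f" unfolding h[symmetric] by (simp add: g_def)
    then show ?thesis by (simp add: algebra_simps)
  qed
  ultimately show "mom \<gamma> (p * q) = 0" by (simp only: mom_add mom_smult)
qed

text \<open>The last two conclusions are the hypotheses of Gauss quadrature with
  \<open>m = 2 * n - 2\<close>; the first permits dividing by t at the nodes. If c had no constant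
  term, c / t would be a kernel polynomial of smaller degree.\<close>

lemma null_generator:
  assumes n: "0 < n" and psd: "semidefinite_on \<gamma> {..<n}"
    and top: "f \<in> null_on \<gamma> {..<n}" "poly.coeff f (n - 1) \<noteq> 0"
    and bot: "g \<in> null_on \<gamma> {..<n}" "poly.coeff g 0 \<noteq> 0"
    and c: "c \<in> null_on \<gamma> {..<n}" "c \<noteq> 0"
    and least: "\<And>p. p \<in> null_on \<gamma> {..<n} \<Longrightarrow> p \<noteq> 0 \<Longrightarrow> degree c \<le> degree p"
  shows "poly.coeff c 0 \<noteq> 0"
    and "degree c + degree q \<le> 2 * n - 2 \<Longrightarrow> mom \<gamma> (c * q) = 0"
    and "p \<noteq> 0 \<Longrightarrow> degree p < degree c \<Longrightarrow> 0 < mom \<gamma> (p * p)"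
proof -
  have deg: "degree c < n" using c(1) polys_on_lessThan[OF n] by (simp add: null_on_def)
  show "poly.coeff c 0 \<noteq> 0"
  proof
    assume "poly.coeff c 0 = 0"
    then obtain h where h: "c = Polynomial.monom 1 1 * h" using mult_monom_1_coeff_0 by blast
    then have "h \<noteq> 0" using c(2) by auto
    then have "degree c = Suc (degree h)" by (simp add: h degree_mult_eq degree_monom_eq)
    moreover from this have "h \<in> polys_on {..<n}" using deg polys_on_lessThan[OF n] by simp
    then have "h \<in> null_on \<gamma> {..<n}"
      using c(1) unfolding h by (rule null_on_unshift[OF psd bot, rotated])
    ultimately show False using least[of h] \<open>h \<noteq> 0\<close> by simp
  qed
  show "0 < mom \<gamma> (p * p)" if "p \<noteq> 0" "degree p < degree c"
  proof -
    have p: "p \<in> polys_on {..<n}" using that deg polys_on_lessThan[OF n] by simp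
    then have "0 \<le> mom \<gamma> (p * p)" using psd by (auto simp: semidefinite_on_def)
    moreover have "mom \<gamma> (p * p) \<noteq> 0" using least[of p] that p by (auto simp: null_on_def)
    ultimately show ?thesis by simp
  qed
  have shifts: "Polynomial.monom 1 j * c \<in> null_on \<gamma> {..<n}" if "degree c + j < n" for j
    using that
  proof (induction j)
    case 0
    then show ?case using c(1) by (simp add: monom_altdef)
  next
    case (Suc j)
    have "degree (Polynomial.monom 1 j * c) = j + degree c"
      using c(2) by (simp add: degree_mult_eq degree_monom_eq)
    then have "Polynomial.monom 1 j * c \<in> polys_on {..<n - 1}"
      using Suc.prems polys_on_lessThan[of "n - 1"] by simp
    then have "Polynomial.monom 1 1 * (Polynomial.monom 1 j * c) \<in> null_on \<gamma> {..<n}"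
      using Suc by (intro null_on_shift[OF psd top]) auto
    then show ?case by (simp add: mult_monom flip: mult.assoc)
  qed
  show "mom \<gamma> (c * q) = 0" if q: "degree c + degree q \<le> 2 * n - 2"
  proof (rule mom_orthogonal[of q "{..degree q}"])
    show "q \<in> polys_on {..degree q}" by (auto simp: polys_on_def le_degree)
    fix i assume i: "i \<in> {..degree q}"
    \<comment> \<open>The exponent i can be as large as \<open>2 * n - 2 - degree c\<close>. It is
      split so that t^j c has degree below \<open>n\<close> and is still null, while the remaining
      factor t^(i - j) has exponent at most \<open>n - 1\<close>.\<close>
    define j where "j = min i (n - 1 - degree c)"
    have "mom \<gamma> (Polynomial.monom 1 j * c * Polynomial.monom 1 (i - j)) = 0"
    proof (rule null_on_orthogonal[OF psd shifts])
      show "degree c + j < n" using deg by (simp add: j_def)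
      show "Polynomial.monom 1 (i - j) \<in> polys_on {..<n}"
        using i q n deg by (intro polys_on_monom) (auto simp: j_def)
    qed
    also have "Polynomial.monom 1 j * c * Polynomial.monom 1 (i - j) = c * Polynomial.monom 1 i"
    proof -
      have "Polynomial.monom (1::real) i = Polynomial.monom 1 j * Polynomial.monom 1 (i - j)"
        by (simp add: mult_monom j_def)
      then show ?thesis by (simp only: mult.assoc mult.left_commute)
    qed
    finally show "mom \<gamma> (c * Polynomial.monom 1 i) = 0" .
  qed simp
qed

section \<open>Representation when the shifted form is singular\<close>

lemma mom_power_sum:
  "mom (\<lambda>i. \<Sum>t\<in>T. w t * t ^ i) p = (\<Sum>t\<in>T. w t * poly p t)"
proof -
  have "mom (\<lambda>i. \<Sum>t\<in>T. w t * t ^ i) p = (\<Sum>t\<in>T. \<Sum>i\<le>degree p. w t * (poly.coeff p i * t ^ i))"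
    unfolding mom_def sum_distrib_left by (subst sum.swap) (simp add: mult.left_commute)
  then show ?thesis by (simp add: poly_altdef sum_distrib_left)
qed

text \<open>The linear factor c(0) - c'(0) t cancels the coefficient of t at the cost of one degree.
  The product still vanishes at the roots of c and has constant term c(0)^2, but lives on the
  exponents 0, 2, ..., \<open>k\<close>, where c itself may not.\<close>

lemma cancel_linear_coeff:
  fixes c :: "real poly"
  assumes "degree c < k"
  shows "c * [:poly.coeff c 0, - poly.coeff c 1:] \<in> polys_on ({..k} - {1})"
proof -
  let ?q = "c * [:poly.coeff c 0, - poly.coeff c 1:]"
  have "degree ?q \<le> k"
    using assms degree_mult_le[of c "[:poly.coeff c 0, - poly.coeff c 1:]"] by (auto split: if_splits)
  then have "i \<le> k" if "poly.coeff ?q i \<noteq> 0" for i using le_degree[OF that] by simp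
  moreover have "poly.coeff ?q 1 = 0" by (simp add: coeff_mult)
  ultimately show ?thesis by (auto simp: polys_on_def)
qed

text \<open>An atom at 0 is added exactly when the deficit \<open>d\<close> is nonzero. Since
  \<open>d\<close> multiplies the squared constant term, polynomials on the exponents 0, 2, ...,
  \<open>k\<close> detect it without knowledge of the first moment.\<close>

lemma representation_singular:
  fixes \<beta> :: "nat \<Rightarrow> real"
  defines "\<gamma> \<equiv> \<lambda>i. \<beta> (i + 2)"
  assumes k: "1 < k" and psd: "semidefinite_on \<gamma> {..<k}" and psd0: "semidefinite_on \<beta> ({..k} - {1})"
    and top: "f \<in> null_on \<gamma> {..<k}" "poly.coeff f (k - 1) \<noteq> 0"
    and bot: "g \<in> null_on \<gamma> {..<k}" "poly.coeff g 0 \<noteq> 0"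
    and c: "c \<in> null_on \<gamma> {..<k}" "c \<noteq> 0"
    and least: "\<And>p. p \<in> null_on \<gamma> {..<k} \<Longrightarrow> p \<noteq> 0 \<Longrightarrow> degree c \<le> degree p"
  obtains x T w where "finite T" "\<And>t. t \<in> T \<Longrightarrow> 0 < w t"
    "\<And>i. i \<le> 2 * k \<Longrightarrow> (\<beta>(1 := x)) i = (\<Sum>t\<in>T. w t * t ^ i)"
    "card T = degree c + (if \<exists>p\<in>null_on \<beta> ({..k} - {1}). poly.coeff p 0 \<noteq> 0 then 0 else 1)"
proof -
  note gen = null_generator[OF _ psd top bot c least]
  have deg: "degree c < k"
    using c(1) polys_on_lessThan[of k] k by (simp add: null_on_def)
  obtain T w where T: "finite T" "card T = degree c" "\<And>t. t \<in> T \<Longrightarrow> poly c t = 0"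
    and w: "\<And>t. t \<in> T \<Longrightarrow> 0 < w t"
    and quad: "\<And>p. degree p \<le> 2 * k - 2 \<Longrightarrow> mom \<gamma> p = (\<Sum>t\<in>T. w t * poly p t)"
  proof (rule gauss_quadrature[OF c(2), of "2 * k - 2" \<gamma>])
    show "2 * degree c \<le> 2 * k - 2 + 2" using deg by simp
  qed (use gen k in auto)
  have c0: "poly.coeff c 0 \<noteq> 0" using gen(1) k by simp
  have "0 \<notin> T" using T(3)[of 0] c0 by (auto simp: poly_0_coeff_0)
  define v where "v t = w t / t ^ 2" for t
  have v: "0 < v t" if "t \<in> T" for t
    using w[OF that] that \<open>0 \<notin> T\<close> by (auto simp: v_def intro!: divide_pos_pos)
  \<comment> \<open>\<open>d\<close> is what the atoms at the roots of c leave of the zeroth moment;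
    the free moment \<open>x\<close> is then the first moment of these atoms, to which mass at 0
    contributes nothing.\<close>
  define d where "d = \<beta> 0 - (\<Sum>t\<in>T. v t)"
  define x where "x = (\<Sum>t\<in>T. v t * t)"
  have rep: "(\<beta>(1 := x)) i = (\<Sum>t\<in>T. v t * t ^ i) + (if i = 0 then d else 0)" if "i \<le> 2 * k" for i
  proof -
    consider "i = 0" | "i = 1" | "2 \<le> i" by linarith
    then show ?thesis
    proof cases
      assume "2 \<le> i"
      then obtain j where 3: "i = j + 2" "j \<le> 2 * k - 2"
        using \<open>i \<le> 2 * k\<close> by (metis le_add_diff_inverse2 diff_le_mono)
      have "\<beta> i = mom \<gamma> (Polynomial.monom 1 j)" by (simp add: 3 \<gamma>_def)
      also have "\<dots> = (\<Sum>t\<in>T. w t * t ^ j)"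
        using 3 by (subst quad) (simp_all add: degree_monom_eq poly_monom)
      also have "\<dots> = (\<Sum>t\<in>T. v t * t ^ i)"
      proof (rule sum.cong)
        fix t assume "t \<in> T"
        then have "t \<noteq> 0" using \<open>0 \<notin> T\<close> by blast
        then show "w t * t ^ j = v t * t ^ i" by (simp add: v_def 3 power_add power2_eq_square)
      qed simp
      finally show ?thesis using 3 by simp
    qed (simp_all add: d_def x_def)
  qed
  \<comment> \<open>Without a linear coefficient the functional does not see the first moment, so
    the formula holds for \<open>\<beta>\<close> itself, whatever \<open>\<beta> 1\<close>
    is.\<close>
  have mom_rep: "mom \<beta> p = (\<Sum>t\<in>T. v t * poly p t) + d * poly.coeff p 0"
    if p: "poly.coeff p 1 = 0" "degree p \<le> 2 * k" for p
  proof -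
    have "mom \<beta> p = (\<Sum>i\<le>2*k. poly.coeff p i * (\<Sum>t\<in>T. v t * t ^ i) + (if i = 0 then d * poly.coeff p 0 else 0))"
      unfolding mom_eq[OF p(2)]
    proof (rule sum.cong)
      fix i assume "i \<in> {..2*k}"
      then show "poly.coeff p i * \<beta> i = poly.coeff p i * (\<Sum>t\<in>T. v t * t ^ i) + (if i = 0 then d * poly.coeff p 0 else 0)"
        using rep[of i] p(1) by (cases "i = 1") (auto simp: algebra_simps)
    qed simp
    also have "\<dots> = mom (\<lambda>i. \<Sum>t\<in>T. v t * t ^ i) p + d * poly.coeff p 0"
      using p(2) by (simp add: sum.distrib mom_eq[of p "2 * k"])
    finally show ?thesis by (simp add: mom_power_sum)
  qed
  have sq: "mom \<beta> (p * p) = (\<Sum>t\<in>T. v t * (poly p t)\<^sup>2) + d * (poly.coeff p 0)\<^sup>2"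
    if p: "p \<in> polys_on ({..k} - {1})" for p
  proof -
    have "degree p \<le> k" using polys_onD[OF p] by (intro degree_le) auto
    then have "degree (p * p) \<le> 2 * k" using degree_mult_le[of p p] by simp
    moreover have "poly.coeff (p * p) 1 = 0"
      using polys_onD[OF p, of 1] by (simp add: coeff_mult)
    moreover have "poly.coeff (p * p) 0 = (poly.coeff p 0)\<^sup>2"
      by (simp add: coeff_mult power2_eq_square)
    ultimately show ?thesis using mom_rep[of "p * p"] by (simp add: power2_eq_square)
  qed
  \<comment> \<open>q vanishes at every node in \<open>T\<close>, so its square measures
    \<open>d\<close> alone; semidefiniteness on 0, 2, ..., \<open>k\<close> then gives
    \<open>0 \<le> d\<close>.\<close>
  define q where "q = c * [:poly.coeff c 0, - poly.coeff c 1:]"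
  have q0: "poly.coeff q 0 \<noteq> 0" using c0 by (simp add: q_def)
  have q_in: "q \<in> polys_on ({..k} - {1})"
    unfolding q_def using deg by (rule cancel_linear_coeff)
  have q_sq: "mom \<beta> (q * q) = d * (poly.coeff q 0)\<^sup>2"
  proof -
    have "poly q t = 0" if "t \<in> T" for t using T(3)[OF that] by (simp add: q_def)
    then show ?thesis by (simp add: sq[OF q_in])
  qed
  then have "0 \<le> d" using psd0 q_in q0 by (auto simp: semidefinite_on_def zero_le_mult_iff)
  have iff: "(\<exists>p\<in>null_on \<beta> ({..k} - {1}). poly.coeff p 0 \<noteq> 0) \<longleftrightarrow> d = 0"
  proof
    assume "\<exists>p\<in>null_on \<beta> ({..k} - {1}). poly.coeff p 0 \<noteq> 0"
    then obtain p where p: "p \<in> polys_on ({..k} - {1})" "mom \<beta> (p * p) = 0" "poly.coeff p 0 \<noteq> 0"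
      by (auto simp: null_on_def)
    have "0 \<le> (\<Sum>t\<in>T. v t * (poly p t)\<^sup>2)"
      using less_imp_le[OF v] by (intro sum_nonneg mult_nonneg_nonneg) auto
    moreover have "0 \<le> d * (poly.coeff p 0)\<^sup>2" using \<open>0 \<le> d\<close> by simp
    ultimately have "d * (poly.coeff p 0)\<^sup>2 = 0" using sq[OF p(1)] p(2) by linarith
    then show "d = 0" using p(3) by simp
  next
    assume "d = 0"
    then show "\<exists>p\<in>null_on \<beta> ({..k} - {1}). poly.coeff p 0 \<noteq> 0"
      using q_in q_sq q0 by (auto simp: null_on_def)
  qed
  show thesis
  proof (cases "d = 0")
    case True
    show ?thesis
    proof (rule that[of T v x])
      show "(\<beta>(1 := x)) i = (\<Sum>t\<in>T. v t * t ^ i)" if "i \<le> 2 * k" for i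
        using rep[OF that] True by simp
    qed (use T v iff True in auto)
  next
    case False
    have eq: "(\<Sum>t\<in>T. (if t = 0 then d else v t) * t ^ i) = (\<Sum>t\<in>T. v t * t ^ i)" for i
      using \<open>0 \<notin> T\<close> by (intro sum.cong) auto
    show ?thesis
    proof (rule that[of "insert 0 T" "\<lambda>t. if t = 0 then d else v t" x])
      show "(\<beta>(1 := x)) i = (\<Sum>t\<in>insert 0 T. (if t = 0 then d else v t) * t ^ i)" if "i \<le> 2 * k" for i
        unfolding rep[OF that] sum.insert[OF T(1) \<open>0 \<notin> T\<close>] eq by simp
    qed (use T v iff False \<open>0 \<le> d\<close> \<open>0 \<notin> T\<close> in auto)
  qed
qed

text \<open>Gram-Schmidt by induction on \<open>S\<close>. The claim is generalised over f because
  the step projects not only f but also the new monomial.\<close>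

lemma definite_projection:
  assumes "finite S" "definite_on \<beta> S"
  obtains h where "h \<in> polys_on S" "\<And>p. p \<in> polys_on S \<Longrightarrow> mom \<beta> ((f - h) * p) = 0"
proof -
  have "\<exists>h\<in>polys_on S. \<forall>i\<in>S. mom \<beta> ((f - h) * Polynomial.monom 1 i) = 0"
    using assms
  proof (induction S arbitrary: f rule: finite_induct)
    case (insert s S)
    have def: "definite_on \<beta> S" using insert.prems by (rule definite_on_mono) auto
    obtain h where h: "h \<in> polys_on S" "\<forall>i\<in>S. mom \<beta> ((f - h) * Polynomial.monom 1 i) = 0"
      using insert.IH[OF def] by blast
    obtain l where l: "l \<in> polys_on S" "\<forall>i\<in>S. mom \<beta> ((Polynomial.monom 1 s - l) * Polynomial.monom 1 i) = 0"
      using insert.IH[OF def] by blast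
    define g where "g = Polynomial.monom 1 s - l"
    have sub: "polys_on S \<subseteq> polys_on (insert s S)" by (rule polys_on_mono) auto
    have g: "g \<in> polys_on (insert s S)"
      unfolding g_def using l(1) sub by (intro polys_on_diff polys_on_monom) auto
    have "poly.coeff g s = 1" using polys_onD[OF l(1) insert.hyps(2)] by (simp add: g_def)
    then have "0 < mom \<beta> (g * g)" using insert.prems g by (force simp: definite_on_def)
    moreover have gl: "mom \<beta> (g * l) = 0"
      using mom_orthogonal[OF l(1) insert.hyps(1), of \<beta> g] l(2) by (simp add: g_def)
    have "Polynomial.monom 1 s = g + l" by (simp add: g_def)
    then have "mom \<beta> (g * Polynomial.monom 1 s) = mom \<beta> (g * g)"
      by (simp add: ring_distribs mom_add gl)
    ultimately have pos: "0 < mom \<beta> (g * Polynomial.monom 1 s)" by simp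
    \<comment> \<open>g is orthogonal to the old monomials, so adding a multiple of it to h changes
      only the pairing with the new one.\<close>
    define a where "a = mom \<beta> ((f - h) * Polynomial.monom 1 s) / mom \<beta> (g * Polynomial.monom 1 s)"
    have expand: "mom \<beta> ((f - (h + Polynomial.smult a g)) * q) = mom \<beta> ((f - h) * q) - a * mom \<beta> (g * q)" for q
    proof -
      have "(f - (h + Polynomial.smult a g)) * q = (f - h) * q - Polynomial.smult a (g * q)"
        by (simp add: algebra_simps)
      then show ?thesis by (simp only: mom_diff mom_smult)
    qed
    show ?case
    proof (rule bexI[of _ "h + Polynomial.smult a g"], intro ballI)
      show "h + Polynomial.smult a g \<in> polys_on (insert s S)"
        using h(1) sub g by (intro polys_on_add polys_on_smult) auto
      fix i assume "i \<in> insert s S"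
      then show "mom \<beta> ((f - (h + Polynomial.smult a g)) * Polynomial.monom 1 i) = 0"
        unfolding expand using h(2) l(2) pos by (auto simp: a_def g_def)
    qed
  qed (auto intro: exI[of _ 0])
  then obtain h where h: "h \<in> polys_on S" "\<forall>i\<in>S. mom \<beta> ((f - h) * Polynomial.monom 1 i) = 0" by blast
  show thesis
    by (rule that[OF h(1)]) (use mom_orthogonal[OF _ assms(1)] h(2) in blast)
qed

lemma mom_upd: "mom (\<beta>(1 := x)) p = mom \<beta> p + (x - \<beta> 1) * poly.coeff p 1"
proof -
  define N where "N = max 1 (degree p)"
  have N: "degree p \<le> N" by (simp add: N_def)
  have "mom (\<beta>(1 := x)) p = (\<Sum>i\<le>N. poly.coeff p i * \<beta> i + (if i = 1 then (x - \<beta> 1) * poly.coeff p 1 else 0))"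
    unfolding mom_eq[of p N, OF N]
    by (rule sum.cong) (auto simp: algebra_simps)
  also have "\<dots> = mom \<beta> p + (x - \<beta> 1) * poly.coeff p 1"
    using mom_eq[of p N] by (simp add: sum.distrib N_def)
  finally show ?thesis .
qed

text \<open>
  Orthogonalising \<open>1\<close> and \<open>t\<close> against \<open>t\<^sup>2, \<dots>, t\<^sup>k\<close> gives \<open>q\<close> and \<open>g\<close>, whose inner product is the only one
  involving the free moment. The two extremal values of that moment make the form singular, with
  kernel spanned by \<open>c = q - s g\<close>, and the sign of \<open>s\<close> is chosen such that \<open>c\<close> has degree \<open>k\<close>.
\<close>

lemma representation_definite:
  assumes k: "1 < k" and psd0: "semidefinite_on \<beta> ({..k} - {1})" and def: "definite_on \<beta> {1..k}"
    and def0: "definite_on \<beta> ({..<k} - {1})"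
  obtains x T w where "finite T" "card T = k" "\<And>t. t \<in> T \<Longrightarrow> 0 < w t"
    "\<And>i. i \<le> 2 * k \<Longrightarrow> (\<beta>(1 := x)) i = (\<Sum>t\<in>T. w t * t ^ i)"
proof -
  let ?X = "Polynomial.monom 1 1 :: real poly"
  let ?S = "{2..k}"
  have def2: "definite_on \<beta> ?S" by (rule definite_on_mono[OF def]) auto
  obtain hq where hq: "hq \<in> polys_on ?S" "\<And>p. p \<in> polys_on ?S \<Longrightarrow> mom \<beta> ((1 - hq) * p) = 0"
    using definite_projection[OF _ def2, of 1] by auto
  obtain hg where hg: "hg \<in> polys_on ?S" "\<And>p. p \<in> polys_on ?S \<Longrightarrow> mom \<beta> ((?X - hg) * p) = 0"
    using definite_projection[OF _ def2, of ?X] by auto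
  define q where "q = 1 - hq"
  define g where "g = ?X - hg"
  have q_orth: "mom \<beta> (q * p) = 0" and g_orth: "mom \<beta> (g * p) = 0" if "p \<in> polys_on ?S" for p
    using hq(2) hg(2) that by (simp_all add: q_def g_def)
  have cq: "poly.coeff q 0 = 1" "poly.coeff q 1 = 0" "\<And>i. k < i \<Longrightarrow> poly.coeff q i = 0"
    using polys_onD[OF hq(1)] k by (auto simp: q_def)
  have cg: "poly.coeff g 0 = 0" "poly.coeff g 1 = 1" "\<And>i. k < i \<Longrightarrow> poly.coeff g i = 0"
    using polys_onD[OF hg(1)] k by (auto simp: g_def)
  have q_in: "q \<in> polys_on ({..k} - {1})" and g_in: "g \<in> polys_on {1..k}"
    unfolding polys_on_def using cq cg by (auto simp: not_le Suc_le_eq) (metis not_le gr0I)+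
  define \<delta> where "\<delta> = mom \<beta> (q * q)"
  define G where "G = mom \<beta> (g * g)"
  have "0 \<le> \<delta>" using psd0 q_in by (auto simp: semidefinite_on_def \<delta>_def)
  have "g \<noteq> 0" using cg(2) by auto
  then have "0 < G" using def g_in by (auto simp: definite_on_def G_def)
  \<comment> \<open>On the span of q and g the form has diagonal entries \<open>\<delta>\<close> and
    \<open>G\<close>. With off-diagonal entry s G its determinant is \<open>\<delta>\<close> G - s^2
    G^2, which vanishes exactly for s = r and s = -r.\<close>
  define r where "r = sqrt (\<delta> / G)"
  have r2: "r\<^sup>2 * G = \<delta>" using \<open>0 \<le> \<delta>\<close> \<open>0 < G\<close> by (simp add: r_def)
  \<comment> \<open>If both signs failed, q would lack the exponent \<open>k\<close>; then
    \<open>def0\<close> gives \<open>0 < \<delta>\<close>, so r is nonzero and g lacks it too. Hence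
    t g is orthogonal to q and t q - t to g. But q (t g) = g (t q), and g pairs with t to
    \<open>G > 0\<close>, a contradiction.\<close>
  have "\<exists>s. s\<^sup>2 = r\<^sup>2 \<and> poly.coeff q k - s * poly.coeff g k \<noteq> 0"
  proof (rule ccontr)
    assume "\<not> ?thesis"
    then have *: "poly.coeff q k - r * poly.coeff g k = 0" "poly.coeff q k - (- r) * poly.coeff g k = 0"
      using power2_minus[of r] by blast+
    then have qk: "poly.coeff q k = 0" and rg: "r * poly.coeff g k = 0" by linarith+
    have q_in': "q \<in> polys_on ({..<k} - {1})"
      using q_in qk by (auto simp: polys_on_def le_less)
    have "q \<noteq> 0" using cq(1) by auto
    then have "0 < \<delta>" using def0 q_in' by (auto simp: definite_on_def \<delta>_def)
    then have "r \<noteq> 0" using \<open>0 < G\<close> by (simp add: r_def)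
    then have gk: "poly.coeff g k = 0" using rg by simp
    have "?X * g \<in> polys_on ?S"
      unfolding polys_on_def
    proof safe
      fix i assume i: "poly.coeff (?X * g) i \<noteq> 0"
      then have "poly.coeff g (i - 1) \<noteq> 0" "i \<noteq> 0" by (auto simp: coeff_monom_mult split: if_splits)
      then have "i - 1 \<in> {1..k}" "i - 1 \<noteq> k" using gk g_in by (auto simp: polys_on_def)
      then show "i \<in> ?S" by auto
    qed
    then have 1: "mom \<beta> (q * (?X * g)) = 0" by (rule q_orth)
    have "?X * q - ?X \<in> polys_on ?S"
      unfolding polys_on_def
    proof safe
      fix i assume i: "poly.coeff (?X * q - ?X) i \<noteq> 0"
      then have "i \<noteq> 0" "i \<noteq> 1" using cq(1) by (auto simp: coeff_monom_mult split: if_splits)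
      then have "poly.coeff q (i - 1) \<noteq> 0" using i by (auto simp: coeff_monom_mult split: if_splits)
      then have "i - 1 \<in> {..k}" "i - 1 \<noteq> k" using qk q_in by (auto simp: polys_on_def)
      then show "i \<in> ?S" using \<open>i \<noteq> 0\<close> \<open>i \<noteq> 1\<close> by auto
    qed
    then have 2: "mom \<beta> (g * (?X * q - ?X)) = 0" by (rule g_orth)
    have "q * (?X * g) = g * (?X * q - ?X) + (g * g + g * hg)"
      by (simp add: g_def algebra_simps)
    then have "mom \<beta> (q * (?X * g)) = mom \<beta> (g * (?X * q - ?X)) + (G + mom \<beta> (g * hg))"
      by (simp only: mom_add G_def)
    then show False using 1 2 g_orth[OF hg(1)] \<open>0 < G\<close> by simp
  qed
  then obtain s where s: "s\<^sup>2 = r\<^sup>2" "poly.coeff q k - s * poly.coeff g k \<noteq> 0" by blast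
  \<comment> \<open>q g has linear coefficient 1, so shifting the free moment shifts the pairing of
    q and g by the same amount; this value makes it s G.\<close>
  define x where "x = \<beta> 1 + (s * G - mom \<beta> (q * g))"
  let ?L = "mom (\<beta>(1 := x))"
  have L: "?L p = mom \<beta> p" if "poly.coeff p 1 = 0" for p
    using that by (simp add: mom_upd del: One_nat_def)
  have L_qg: "?L (q * g) = s * G"
    unfolding mom_upd using cq cg by (simp add: coeff_mult x_def)
  have L_qq: "?L (q * q) = \<delta>" using cq by (subst L) (auto simp: coeff_mult \<delta>_def)
  have L_gg: "?L (g * g) = G" using cg by (subst L) (auto simp: coeff_mult G_def)
  define c where "c = q - Polynomial.smult s g"
  have c0: "poly.coeff c 0 = 1" and ck: "poly.coeff c k \<noteq> 0"
    using cq cg s(2) by (simp_all add: c_def)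
  have deg_c: "degree c = k"
    using ck cq(3) cg(3) by (intro antisym degree_le le_degree) (auto simp: c_def)
  have c_g: "?L (c * g) = 0"
  proof -
    have "c * g = q * g - Polynomial.smult s (g * g)" by (simp add: c_def algebra_simps)
    then show ?thesis by (simp add: mom_diff mom_smult L_qg L_gg del: One_nat_def)
  qed
  have c_q: "?L (c * q) = 0"
  proof -
    have "c * q = q * q - Polynomial.smult s (q * g)" by (simp add: c_def algebra_simps)
    then have "?L (c * q) = \<delta> - s\<^sup>2 * G"
      by (simp add: mom_diff mom_smult L_qg L_qq power2_eq_square del: One_nat_def)
    then show ?thesis by (simp add: s(1) r2)
  qed
  have c_S: "?L (c * p) = 0" if p: "p \<in> polys_on ?S" for p
  proof -
    have "poly.coeff (c * p) 1 = 0" using polys_onD[OF p] by (simp add: coeff_mult)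
    then have "?L (c * p) = mom \<beta> (c * p)" by (rule L)
    also have "\<dots> = mom \<beta> (q * p - Polynomial.smult s (g * p))"
      by (simp add: c_def algebra_simps)
    also have "\<dots> = 0" using q_orth[OF p] g_orth[OF p] by (simp add: mom_diff mom_smult)
    finally show ?thesis .
  qed
  have orth: "?L (c * p) = 0" if p: "degree p \<le> k" for p
  proof -
    define a b where "a = poly.coeff p 0" and "b = poly.coeff p 1"
    \<comment> \<open>q and g carry the coefficients at 0 and 1, so subtracting them leaves
      exponents 2, ..., \<open>k\<close>, to which both are orthogonal.\<close>
    define h where "h = p - Polynomial.smult a q - Polynomial.smult b g"
    have "poly.coeff h i = 0" if i: "i \<notin> ?S" for i
    proof -
      from i have "i = 0 \<or> i = 1 \<or> k < i" by auto
      then consider "i = 0" | "i = 1" | "k < i" by blast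
      then show ?thesis
        using cq cg p by cases (simp_all add: h_def a_def b_def coeff_eq_0 del: One_nat_def)
    qed
    then have "h \<in> polys_on ?S" by (auto simp: polys_on_def)
    then have "?L (c * h) = 0" by (rule c_S)
    moreover have "c * p = c * h + Polynomial.smult a (c * q) + Polynomial.smult b (c * g)"
      by (simp add: h_def algebra_simps)
    ultimately show ?thesis by (simp only: mom_add mom_smult c_q c_g)
  qed
  have pos: "0 < ?L (p * p)" if p: "p \<noteq> 0" "degree p < k" for p
  proof -
    define a where "a = poly.coeff p 0"
    \<comment> \<open>Subtracting a multiple of c, which is orthogonal to all degrees up to
      \<open>k\<close>, leaves the square unchanged and removes the constant term; on 1, ...,
      \<open>k\<close> the form is definite. The difference is nonzero because c has degree
      \<open>k\<close> and p does not.\<close>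
    define f where "f = p - Polynomial.smult a c"
    have f: "f \<in> polys_on {1..k}"
      unfolding polys_on_def
    proof safe
      fix i assume i: "poly.coeff f i \<noteq> 0"
      have "i \<noteq> 0" using i c0 by (cases "i = 0") (auto simp: f_def a_def)
      moreover have "i \<le> k"
      proof (rule ccontr)
        assume "\<not> i \<le> k"
        then show False using i p(2) deg_c by (simp add: f_def coeff_eq_0)
      qed
      ultimately show "i \<in> {1..k}" by simp
    qed
    have "f \<noteq> 0"
    proof
      assume f0: "f = 0"
      then have "poly.coeff p k = a * poly.coeff c k" by (simp add: f_def)
      then have "a = 0" using p(2) ck by (simp add: coeff_eq_0)
      then show False using f0 p(1) by (simp add: f_def)
    qed
    have "p * p = f * f + Polynomial.smult a (c * (p + f))"
      by (simp add: f_def algebra_simps smult_diff_right)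
    moreover have "degree f \<le> k"
      using polys_onD[OF f] by (intro degree_le) auto
    then have "?L (c * (p + f)) = 0"
      using p(2) by (intro orth degree_add_le) auto
    ultimately have "?L (p * p) = ?L (f * f)" by (simp add: mom_add mom_smult)
    also have "\<dots> = mom \<beta> (f * f)"
      using polys_onD[OF f, of 0] by (intro L) (simp add: coeff_mult)
    also have "0 < \<dots>" using def f \<open>f \<noteq> 0\<close> by (auto simp: definite_on_def)
    finally show ?thesis .
  qed
  have "c \<noteq> 0" using c0 by auto
  then obtain T w where T: "finite T" "card T = degree c" "\<And>t. t \<in> T \<Longrightarrow> 0 < w t"
    and quad: "\<And>p. degree p \<le> 2 * k \<Longrightarrow> ?L p = (\<Sum>t\<in>T. w t * poly p t)"
  proof (rule gauss_quadrature[of c "2 * k" "\<beta>(1 := x)"])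
    show "?L (c * p) = 0" if "degree c + degree p \<le> 2 * k" for p
      using that deg_c by (intro orth) simp
    show "0 < ?L (p * p)" if "p \<noteq> 0" "degree p < degree c" for p
      using that deg_c by (intro pos) simp_all
  qed (auto simp: deg_c)
  show thesis
  proof (rule that[of T w x])
    fix i assume i: "i \<le> 2 * k"
    have "(\<beta>(1 := x)) i = ?L (Polynomial.monom 1 i)" by simp
    also have "\<dots> = (\<Sum>t\<in>T. w t * t ^ i)"
      using i by (subst quad) (simp_all add: degree_monom_eq poly_monom)
    finally show "(\<beta>(1 := x)) i = (\<Sum>t\<in>T. w t * t ^ i)" .
  qed (use T deg_c in auto)
qed

section \<open>Measures\<close>

lemma representing_measure_segment:
  "representing_measure \<mu> (segment \<beta> 0 N) \<longleftrightarrow>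
    sets \<mu> = sets borel \<and> (\<forall>i\<le>N. has_bochner_integral \<mu> (\<lambda>t. t ^ i) (\<beta> i))"
  unfolding representing_measure_def segment_def
  by (auto simp: less_Suc_eq_le simp del: upt_Suc)

lemma representing_measure_poly:
  assumes "representing_measure \<mu> (segment \<beta> 0 N)" "degree p \<le> N"
  shows "has_bochner_integral \<mu> (poly p) (mom \<beta> p)"
proof -
  have "has_bochner_integral \<mu> (\<lambda>t. \<Sum>i\<le>degree p. poly.coeff p i * t ^ i) (\<Sum>i\<le>degree p. poly.coeff p i * \<beta> i)"
    using assms unfolding representing_measure_segment
    by (intro has_bochner_integral_sum has_bochner_integral_mult_right) auto
  then show ?thesis by (simp add: mom_def poly_altdef[abs_def])
qed

lemma representing_measure_square:
  assumes "representing_measure \<mu> (segment \<beta> 0 N)" "2 * degree p \<le> N"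
  shows "0 \<le> mom \<beta> (p * p)" "mom \<beta> (p * p) = 0 \<longleftrightarrow> (AE t in \<mu>. poly p t = 0)"
proof -
  have "degree (p * p) \<le> N" using assms(2) degree_mult_le[of p p] by simp
  from representing_measure_poly[OF assms(1) this]
  have int: "integrable \<mu> (\<lambda>t. (poly p t)\<^sup>2)" "integral\<^sup>L \<mu> (\<lambda>t. (poly p t)\<^sup>2) = mom \<beta> (p * p)"
    by (auto simp: has_bochner_integral_iff power2_eq_square poly_mult[abs_def])
  show "0 \<le> mom \<beta> (p * p)" unfolding int(2)[symmetric] by simp
  show "mom \<beta> (p * p) = 0 \<longleftrightarrow> (AE t in \<mu>. poly p t = 0)"
    unfolding int(2)[symmetric] using integral_nonneg_eq_0_iff_AE[OF int(1)] by simp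
qed

lemma atomic_representing_measure_exists:
  assumes T: "finite T" and w: "\<And>t. t \<in> T \<Longrightarrow> 0 < w t"
    and rep: "\<And>i. i \<le> N \<Longrightarrow> \<beta> i = (\<Sum>t\<in>T. w t * t ^ i)"
  shows "\<exists>\<mu>. representing_measure \<mu> (segment \<beta> 0 N) \<and> atomic_measure (card T) \<mu>"
proof -
  define M where "M = point_measure T (\<lambda>t. ennreal (w t))"
  \<comment> \<open>\<open>point_measure\<close> carries all subsets of \<open>T\<close>; the
    push-forward moves it to the Borel sets of the line, as \<open>representing_measure\<close>
    requires.\<close>
  define \<mu> where "\<mu> = distr M borel (\<lambda>x. x)"
  have meas: "(\<lambda>x. x) \<in> M \<rightarrow>\<^sub>M borel" by (auto simp: M_def space_point_measure)
  have "has_bochner_integral \<mu> (\<lambda>t. t ^ i) (\<beta> i)" if "i \<le> N" for i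
  proof -
    have "integrable M (\<lambda>t. t ^ i)"
      unfolding M_def by (rule integrable_point_measure_finite[OF T])
    then have "integrable \<mu> (\<lambda>t. t ^ i)"
      unfolding \<mu>_def by (subst integrable_distr_eq[OF meas]) auto
    moreover have "integral\<^sup>L \<mu> (\<lambda>t. t ^ i) = integral\<^sup>L M (\<lambda>t. t ^ i)"
      unfolding \<mu>_def by (rule integral_distr[OF meas]) simp
    moreover have "\<dots> = (\<Sum>t\<in>T. w t * t ^ i)"
      unfolding M_def using w
      by (subst lebesgue_integral_point_measure_finite[OF T]) (auto simp: less_imp_le)
    ultimately show ?thesis using rep[OF that] by (simp add: has_bochner_integral_iff)
  qed
  then have "representing_measure \<mu> (segment \<beta> 0 N)"
    by (simp add: representing_measure_segment \<mu>_def)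
  moreover have "emeasure \<mu> B = (\<Sum>t\<in>T. ennreal (w t) * emeasure (return borel t) B)" if "B \<in> sets borel" for B
  proof -
    have "emeasure \<mu> B = emeasure M (B \<inter> T)"
      unfolding \<mu>_def using that by (subst emeasure_distr[OF meas]) (auto simp: M_def space_point_measure)
    also have "\<dots> = (\<Sum>t\<in>B \<inter> T. ennreal (w t))"
      unfolding M_def using T by (intro emeasure_point_measure_finite) auto
    also have "\<dots> = (\<Sum>t\<in>T. ennreal (w t) * emeasure (return borel t) B)"
      using T that by (simp add: indicator_def sum.inter_filter Int_def if_distrib conj_commute cong: if_cong)
    finally show ?thesis .
  qed
  then have "atomic_measure (card T) \<mu>"
    unfolding atomic_measure_def using T w
    by (intro conjI exI[of _ T] exI[of _ w] ballI) (simp_all add: \<mu>_def)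
  ultimately show ?thesis by blast
qed

text \<open>Arbitrary \<open>P\<close> is covered: the complement of the finite set \<open>T\<close>
  is a Borel null set, and conversely a null set contains none of the atoms.\<close>

lemma AE_atomic_measure:
  fixes \<mu> :: "real measure"
  assumes "sets \<mu> = sets borel" "finite T" "\<And>t. t \<in> T \<Longrightarrow> 0 < w t"
    and em: "\<And>B. B \<in> sets borel \<Longrightarrow> emeasure \<mu> B = (\<Sum>t\<in>T. ennreal (w t) * emeasure (return borel t) B)"
  shows "(AE t in \<mu>. P t) \<longleftrightarrow> (\<forall>t\<in>T. P t)"
proof
  have T: "T \<in> sets borel" using borel_closed[OF finite_imp_closed[OF assms(2)]] .
  assume "\<forall>t\<in>T. P t"
  moreover have "AE t in \<mu>. t \<in> T"
  proof (rule AE_I[of _ _ "- T"])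
    have "emeasure \<mu> (- T) = (\<Sum>t\<in>T. ennreal (w t) * emeasure (return borel t) (- T))"
      using T by (intro em) simp
    also have "\<dots> = 0" using T by (intro sum.neutral) simp
    finally show "emeasure \<mu> (- T) = 0" .
  qed (use T assms(1) in auto)
  ultimately show "AE t in \<mu>. P t" by auto
next
  have space: "space \<mu> = UNIV" using sets_eq_imp_space_eq[OF assms(1)] by simp
  assume "AE t in \<mu>. P t"
  then obtain N where N: "{t \<in> space \<mu>. \<not> P t} \<subseteq> N" "emeasure \<mu> N = 0" "N \<in> sets \<mu>"
    by (rule AE_E)
  show "\<forall>t\<in>T. P t"
  proof (intro ballI, rule ccontr)
    fix t assume t: "t \<in> T" "\<not> P t"
    then have "t \<in> N" using N(1) space by auto
    have "N \<in> sets borel" using N(3) assms(1) by simp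
    then have "(\<Sum>t\<in>T. ennreal (w t) * emeasure (return borel t) N) = 0" using em N(2) by simp
    then have "ennreal (w t) * emeasure (return borel t) N = 0"
      using t(1) assms(2) by (simp add: sum_eq_0_iff)
    then show False using assms(3)[OF t(1)] \<open>t \<in> N\<close> \<open>N \<in> sets borel\<close> by simp
  qed
qed

section \<open>The matrices of the statement as Gram matrices\<close>

lemma length_segment [simp]: "length (segment \<beta> a b) = Suc b - a"
  by (simp add: segment_def del: upt_Suc)

lemma nth_segment: "a + i \<le> b \<Longrightarrow> segment \<beta> a b ! i = \<beta> (a + i)"
  by (simp add: segment_def del: upt_Suc)

lemma hankel_mat_segment:
  assumes "Suc b - a = 2 * n - 1"
  shows "hankel_mat (segment \<beta> a b) = Matrix.mat n n (\<lambda>(i, j). \<beta> (a + i + j))"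
proof -
  have "(Suc b - a + 1) div 2 = n" using assms by (cases n) auto
  then show ?thesis
    unfolding hankel_mat_def Let_def length_segment
    using assms by (auto intro!: eq_matI nth_segment simp: add.assoc)
qed

text \<open>Enumerates 0, 2, 3, ..., the exponents behind the bordered matrices.\<close>

definition skip1 :: "nat \<Rightarrow> nat" where
  "skip1 i = (if i = 0 then 0 else i + 1)"

lemma inj_skip1: "inj_on skip1 A"
  by (auto simp: inj_on_def skip1_def split: if_splits)

lemma skip1_image: "0 < n \<Longrightarrow> skip1 ` {..<n} = {..n} - {1}"
proof (intro equalityI subsetI)
  fix i assume "0 < n" "i \<in> {..n} - {1}"
  then show "i \<in> skip1 ` {..<n}"
    by (intro image_eqI[of _ _ "if i = 0 then 0 else i - 1"]) (auto simp: skip1_def)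
qed (auto simp: skip1_def split: if_splits)

lemma bordered_mat_hmat:
  assumes "0 < n"
  shows "bordered_mat (\<beta> 0) (segment \<beta> 2 n) (hmat \<beta> (\<lambda>i. i + 2) (n - 1)) = hmat \<beta> skip1 n"
proof (rule eq_matI)
  fix i j assume "i < dim_row (hmat \<beta> skip1 n)" "j < dim_col (hmat \<beta> skip1 n)"
  then have ij: "i < n" "j < n" by simp_all
  show "bordered_mat (\<beta> 0) (segment \<beta> 2 n) (hmat \<beta> (\<lambda>i. i + 2) (n - 1)) $$ (i, j) = hmat \<beta> skip1 n $$ (i, j)"
    using ij by (auto simp: bordered_mat_def Let_def hmat_def skip1_def vec_of_list_index nth_segment)
qed (use assms in \<open>auto simp: bordered_mat_def Let_def\<close>)

text \<open>Only the positions (0,1) and (1,0) are unspecified. The principal submatrices to be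
  tested are thus those omitting index 0 or index 1, and each is contained in one of two maximal
  ones.\<close>

lemma partially_pos_semidef_hankel:
  "partially_pos_semidef (hankel_mat (segment ((\<lambda>i. Some (\<beta> i))(1 := None)) 0 (2 * k))) \<longleftrightarrow>
    semidefinite_on \<beta> {1..k} \<and> semidefinite_on \<beta> ({..k} - {1})"
proof -
  define P where "P = Matrix.mat (Suc k) (Suc k) (\<lambda>(i, j). ((\<lambda>i. Some (\<beta> i))(1 := None)) (i + j))"
  have hankel: "hankel_mat (segment ((\<lambda>i. Some (\<beta> i))(1 := None)) 0 (2 * k)) = P"
    unfolding P_def by (subst hankel_mat_segment[of _ _ "Suc k"]) simp_all
  have dim: "dim_row P = Suc k" "dim_col P = Suc k" by (simp_all add: P_def)
  have sym: "square_mat P" "transpose_mat P = P"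
    by (auto simp: P_def add.commute intro!: eq_matI)
  have spec: "(\<forall>i\<in>I. \<forall>j\<in>I. P $$ (i, j) \<noteq> None) \<longleftrightarrow> \<not> {0, 1} \<subseteq> I" if "I \<subseteq> {..<Suc k}" for I
  proof -
    have "P $$ (i, j) = None \<longleftrightarrow> i + j = 1" if "i \<in> I" "j \<in> I" for i j
    proof -
      have "i < Suc k" "j < Suc k" using that \<open>I \<subseteq> {..<Suc k}\<close> by auto
      then show ?thesis by (simp add: P_def)
    qed
    then have "(\<forall>i\<in>I. \<forall>j\<in>I. P $$ (i, j) \<noteq> None) \<longleftrightarrow> (\<forall>i\<in>I. \<forall>j\<in>I. i + j \<noteq> 1)" by simp
    also have "\<dots> \<longleftrightarrow> \<not> {0, 1} \<subseteq> I" by (auto simp: add_is_1) (metis gr0I)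
    finally show ?thesis .
  qed
  have sub: "pos_semidef_mat (map_mat the (submatrix P I I)) \<longleftrightarrow> semidefinite_on \<beta> I"
    if I: "I \<subseteq> {..<Suc k}" "\<not> {0, 1} \<subseteq> I" for I
  proof -
    have fin: "finite I" using I(1) finite_subset by blast
    have card: "card {i. i < Suc k \<and> i \<in> I} = card I" using I(1) by (intro arg_cong[of _ _ card]) auto
    have pick: "pick I i \<in> I" if "i < card I" for i using that by (rule pick_in_set_le)
    have inj: "inj_on (pick I) {..<card I}"
      by (rule inj_onI) (metis lessThan_iff linorder_neqE_nat pick_mono_le less_irrefl)
    have "pick I ` {..<card I} = I"
      by (rule card_subset_eq[OF fin]) (use pick inj in \<open>auto simp: card_image\<close>)
    moreover have "map_mat the (submatrix P I I) = hmat \<beta> (pick I) (card I)"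
    proof (rule eq_matI)
      fix i j assume "i < dim_row (hmat \<beta> (pick I) (card I))" "j < dim_col (hmat \<beta> (pick I) (card I))"
      then have ij: "i < card I" "j < card I" by simp_all
      have "pick I i < Suc k" "pick I j < Suc k" using pick[OF ij(1)] pick[OF ij(2)] I(1) by auto
      moreover have "pick I i + pick I j \<noteq> 1"
        using pick[OF ij(1)] pick[OF ij(2)] I(2) by (auto simp: add_is_1) (metis gr0I)
      ultimately show "map_mat the (submatrix P I I) $$ (i, j) = hmat \<beta> (pick I) (card I) $$ (i, j)"
        using ij by (simp add: dim_submatrix dim card submatrix_index hmat_def) (simp add: P_def)
    qed (simp_all add: dim_submatrix dim card)
    ultimately show ?thesis using pos_semidef_hmat[OF inj] by simp
  qed
  show ?thesis
    unfolding hankel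
  proof
    assume P: "partially_pos_semidef P"
    have *: "semidefinite_on \<beta> I" if I: "I \<subseteq> {..<Suc k}" "\<not> {0, 1} \<subseteq> I" for I
    proof -
      have "\<forall>i\<in>I. \<forall>j\<in>I. P $$ (i, j) \<noteq> None" using spec[OF I(1)] I(2) by (rule iffD2)
      with P I(1) have "pos_semidef_mat (map_mat the (submatrix P I I))"
        unfolding partially_pos_semidef_def dim by presburger
      then show ?thesis using sub[OF I] by (rule iffD1[rotated])
    qed
    show "semidefinite_on \<beta> {1..k} \<and> semidefinite_on \<beta> ({..k} - {1})"
      by (intro conjI *) auto
  next
    assume psd: "semidefinite_on \<beta> {1..k} \<and> semidefinite_on \<beta> ({..k} - {1})"
    show "partially_pos_semidef P"
      unfolding partially_pos_semidef_def dim
    proof (intro conjI sym allI impI)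
      fix I assume I: "I \<subseteq> {..<Suc k}" "\<forall>i\<in>I. \<forall>j\<in>I. P $$ (i, j) \<noteq> None"
      then have n01: "\<not> {0, 1} \<subseteq> I" using spec by blast
      have "I \<subseteq> {1..k} \<or> I \<subseteq> {..k} - {1}"
      proof (cases "0 \<in> I")
        case True
        then show ?thesis using n01 I(1) by auto
      next
        case False
        then have "i \<in> {1..k}" if "i \<in> I" for i using that I(1) by (cases i) auto
        then show ?thesis by blast
      qed
      then have "semidefinite_on \<beta> I" using psd semidefinite_on_mono by blast
      then show "pos_semidef_mat (map_mat the (submatrix P I I))" using sub[OF I(1) n01] by simp
    qed
  qed
qed

section \<open>Independence of the free moment, and the shift by two\<close>

lemma mom_upd_square:
  assumes "p \<in> polys_on S" "0 \<notin> S \<or> 1 \<notin> S"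
  shows "mom (\<beta>(1 := x)) (p * p) = mom \<beta> (p * p)"
proof -
  have "poly.coeff (p * p) 1 = 0"
    using polys_onD[OF assms(1)] assms(2) by (auto simp: coeff_mult)
  then show ?thesis by (simp add: mom_upd del: One_nat_def)
qed

lemma mom_shift_square:
  "mom (\<lambda>i. \<beta> (i + 2)) (p * p) = mom \<beta> ((Polynomial.monom 1 1 * p) * (Polynomial.monom 1 1 * p))"
proof -
  have "Polynomial.monom 1 2 * (p * p) = (Polynomial.monom 1 1 * p) * (Polynomial.monom 1 1 * (p :: real poly))"
    by (simp only: mult.assoc mult.left_commute[of p] mult_monom flip: one_add_one)
       (simp add: mult_monom numeral_2_eq_2 flip: mult.assoc)
  then show ?thesis by (simp only: mom_shift)
qed

text \<open>Multiplication by t carries the form of the shifted sequence to that of the original one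
  on the exponents 1, ..., \<open>k\<close>, the block of the partial matrix without row and column
  0.\<close>

lemma monom_1_polys_on: "p \<in> polys_on {..<k} \<longleftrightarrow> Polynomial.monom 1 1 * p \<in> polys_on {1..k}"
proof
  show "Polynomial.monom 1 1 * p \<in> polys_on {1..k}" if "p \<in> polys_on {..<k}"
    unfolding polys_on_def
  proof safe
    fix i assume "poly.coeff (Polynomial.monom 1 1 * p) i \<noteq> 0"
    then have "1 \<le> i" "poly.coeff p (i - 1) \<noteq> 0" by (auto simp: coeff_monom_mult split: if_splits)
    then show "i \<in> {1..k}" using polys_onD[OF that, of "i - 1"] by force
  qed
  show "p \<in> polys_on {..<k}" if p: "Polynomial.monom 1 1 * p \<in> polys_on {1..k}"
    unfolding polys_on_def
  proof safe
    fix i assume "poly.coeff p i \<noteq> 0"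
    then have "poly.coeff (Polynomial.monom 1 1 * p) (Suc i) \<noteq> 0" by (simp add: coeff_monom_mult)
    then show "i < k" using polys_onD[OF p, of "Suc i"] by force
  qed
qed

lemma polys_on_atLeast1D:
  assumes "p \<in> polys_on {1..k}"
  obtains q where "p = Polynomial.monom 1 1 * q" "q \<in> polys_on {..<k}"
  using mult_monom_1_coeff_0[of p] polys_onD[OF assms, of 0] monom_1_polys_on assms by auto

lemma semidefinite_on_shift:
  "semidefinite_on (\<lambda>i. \<beta> (i + 2)) {..<k} \<longleftrightarrow> semidefinite_on \<beta> {1..k}"
  unfolding semidefinite_on_def mom_shift_square
  using monom_1_polys_on polys_on_atLeast1D by metis

lemma definite_on_shift:
  "definite_on (\<lambda>i. \<beta> (i + 2)) {..<k} \<longleftrightarrow> definite_on \<beta> {1..k}"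
  unfolding definite_on_def mom_shift_square
proof
  assume *: "\<forall>p\<in>polys_on {..<k}. p \<noteq> 0 \<longrightarrow> 0 < mom \<beta> (Polynomial.monom 1 1 * p * (Polynomial.monom 1 1 * p))"
  show "\<forall>p\<in>polys_on {1..k}. p \<noteq> 0 \<longrightarrow> 0 < mom \<beta> (p * p)"
  proof (intro ballI impI)
    fix p assume "p \<in> polys_on {1..k}" "p \<noteq> 0"
    then show "0 < mom \<beta> (p * p)" using * by (elim polys_on_atLeast1D) auto
  qed
next
  assume *: "\<forall>p\<in>polys_on {1..k}. p \<noteq> 0 \<longrightarrow> 0 < mom \<beta> (p * p)"
  show "\<forall>p\<in>polys_on {..<k}. p \<noteq> 0 \<longrightarrow> 0 < mom \<beta> (Polynomial.monom 1 1 * p * (Polynomial.monom 1 1 * p))"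
    using * monom_1_polys_on by simp
qed

text \<open>Realises the rank as the degree of a minimal kernel polynomial, which becomes the number
  of atoms away from 0.\<close>

lemma seq_rank_least_null:
  assumes A: "hankel_mat \<gamma>' = hmat \<gamma> id n" and n: "0 < n" and psd: "semidefinite_on \<gamma> {..<n}"
    and ndef: "\<not> definite_on \<gamma> {..<n}"
  obtains c where "c \<in> null_on \<gamma> {..<n}" "c \<noteq> 0" "degree c = seq_rank \<gamma>'"
    "\<And>p. p \<in> null_on \<gamma> {..<n} \<Longrightarrow> p \<noteq> 0 \<Longrightarrow> degree c \<le> degree p"
proof -
  obtain p where "p \<in> null_on \<gamma> {..<n} \<and> p \<noteq> 0"
    using semidefinite_not_definite[OF psd ndef] by blast
  from ex_has_least_nat[of "\<lambda>p. p \<in> null_on \<gamma> {..<n} \<and> p \<noteq> 0", OF this, of degree]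
  obtain c where c: "c \<in> null_on \<gamma> {..<n}" "c \<noteq> 0"
    "\<And>p. p \<in> null_on \<gamma> {..<n} \<Longrightarrow> p \<noteq> 0 \<Longrightarrow> degree c \<le> degree p" by blast
  have "degree c < n" using c(1) polys_on_lessThan[OF n] by (simp add: null_on_def)
  have "seq_rank \<gamma>' = degree c"
    unfolding seq_rank_not_definite[OF A psd ndef]
    by (rule Least_equality) (use c \<open>degree c < n\<close> in auto)
  with c show thesis by (intro that[of c]) auto
qed

section \<open>What a representing measure forces\<close>

context
  fixes \<mu> :: "real measure" and \<beta> \<gamma> :: "nat \<Rightarrow> real" and x :: real and k :: nat
  assumes k: "1 < k" and rep: "representing_measure \<mu> (segment (\<beta>(1 := x)) 0 (2 * k))"
    and \<gamma>: "\<gamma> = (\<lambda>i. \<beta> (i + 2))"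
begin

text \<open>The measure represents the completed sequence, but as \<open>S\<close> omits 0 or 1,
  squares of polynomials on it do not involve the first moment and can be evaluated with
  \<open>\<beta>\<close>.\<close>

lemma rep_square:
  assumes "p \<in> polys_on S" "S \<subseteq> {..k}" "0 \<notin> S \<or> 1 \<notin> S"
  shows "0 \<le> mom \<beta> (p * p)" "mom \<beta> (p * p) = 0 \<longleftrightarrow> (AE t in \<mu>. poly p t = 0)"
proof -
  have "degree p \<le> k"
    using polys_onD[OF assms(1)] assms(2) by (intro degree_le allI impI) force
  then have "2 * degree p \<le> 2 * k" by simp
  from representing_measure_square[OF rep this]
  show "0 \<le> mom \<beta> (p * p)" "mom \<beta> (p * p) = 0 \<longleftrightarrow> (AE t in \<mu>. poly p t = 0)"
    unfolding mom_upd_square[OF assms(1,3)] by auto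
qed

lemma rep_semidefinite: "S \<subseteq> {..k} \<Longrightarrow> 0 \<notin> S \<or> 1 \<notin> S \<Longrightarrow> semidefinite_on \<beta> S"
  using rep_square(1) by (auto simp: semidefinite_on_def)

text \<open>The factor t is the shift by two read on the measure: only mass away from 0 is
  tested.\<close>

lemma rep_null_iff:
  "p \<in> null_on \<gamma> {..<k} \<longleftrightarrow> degree p < k \<and> (AE t in \<mu>. t * poly p t = 0)"
proof -
  have "mom \<gamma> (p * p) = mom \<beta> ((Polynomial.monom 1 1 * p) * (Polynomial.monom 1 1 * p))"
    unfolding \<gamma> by (rule mom_shift_square)
  moreover have "poly (Polynomial.monom 1 1 * p) t = t * poly p t" for t by (simp add: poly_monom)
  moreover have "p \<in> polys_on {..<k} \<longleftrightarrow> degree p < k" using k by (intro polys_on_lessThan) simp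
  moreover have "{1..k} \<subseteq> {..k}" "0 \<notin> {1..k} \<or> 1 \<notin> {1..k}" by auto
  ultimately show ?thesis
    using rep_square(2)[of "Polynomial.monom 1 1 * p" "{1..k}"] monom_1_polys_on[of p k]
    by (auto simp only: null_on_def mem_Collect_eq)
qed

text \<open>If the shifted form is definite, a null polynomial on 0, 2, ..., \<open>k - 1\<close>
  would vanish almost everywhere and so be null for the shifted form. Otherwise a null polynomial
  exists; multiplying it by a power of t reaches the top exponent, dividing out all factors t
  produces a constant term, and neither affects its zeros off 0.\<close>

lemma rep_cases:
  "(definite_on \<gamma> {..<k} \<and> definite_on \<beta> ({..<k} - {1})) \<or>
   ((\<exists>f\<in>null_on \<gamma> {..<k}. poly.coeff f (k - 1) \<noteq> 0) \<and>
    (\<exists>f\<in>null_on \<gamma> {..<k}. poly.coeff f 0 \<noteq> 0))"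
proof (cases "definite_on \<gamma> {..<k}")
  case True
  have "definite_on \<beta> ({..<k} - {1})"
    unfolding definite_on_def
  proof (intro ballI impI)
    fix p assume p: "p \<in> polys_on ({..<k} - {1})" "p \<noteq> 0"
    have sub: "{..<k} - {1} \<subseteq> {..k}" "0 \<notin> {..<k} - {1} \<or> 1 \<notin> {..<k} - {1}" by auto
    have "mom \<beta> (p * p) \<noteq> 0"
    proof
      assume "mom \<beta> (p * p) = 0"
      then have "AE t in \<mu>. poly p t = 0" using rep_square(2)[OF p(1) sub] by blast
      then have "AE t in \<mu>. t * poly p t = 0" by auto
      moreover have "degree p < k"
        using p(1) polys_on_mono[of "{..<k} - {1}" "{..<k}"] polys_on_lessThan[of k p] k by auto
      ultimately have "p \<in> null_on \<gamma> {..<k}" using rep_null_iff by blast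
      then show False using definite_null[OF True] p(2) by blast
    qed
    moreover have "0 \<le> mom \<beta> (p * p)" using rep_square(1)[OF p(1) sub] .
    ultimately show "0 < mom \<beta> (p * p)" by simp
  qed
  with True show ?thesis by blast
next
  case False
  moreover have "semidefinite_on \<gamma> {..<k}"
    unfolding \<gamma> semidefinite_on_shift by (rule rep_semidefinite) auto
  ultimately obtain p where p: "p \<in> null_on \<gamma> {..<k}" "p \<noteq> 0"
    using semidefinite_not_definite by blast
  then have deg: "degree p < k" and ae: "AE t in \<mu>. t * poly p t = 0" using rep_null_iff by auto
  define f where "f = Polynomial.monom 1 (k - 1 - degree p) * p"
  have df: "degree f = k - 1" using p(2) deg by (simp add: f_def degree_mult_eq degree_monom_eq)
  have "f \<noteq> 0" using p(2) by (simp add: f_def)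
  have "AE t in \<mu>. t * poly f t = 0" using ae by eventually_elim (auto simp: f_def)
  then have "f \<in> null_on \<gamma> {..<k}" using df k by (simp add: rep_null_iff)
  moreover have "poly.coeff f (k - 1) \<noteq> 0" using \<open>f \<noteq> 0\<close> df by (metis leading_coeff_0_iff)
  moreover obtain g where g: "p = [:- 0, 1:] ^ order 0 p * g" "\<not> [:- 0, 1:] dvd g"
    using order_decomp[OF p(2)] by blast
  have "g \<noteq> 0" using p(2) g(1) by auto
  then have "degree p = order 0 p + degree g"
    by (subst g(1)) (simp add: degree_mult_eq degree_power_eq)
  then have "degree g < k" using deg by simp
  moreover have "AE t in \<mu>. t * poly g t = 0"
    using ae
  proof eventually_elim
    case (elim t)
    have "poly p t = t ^ order 0 p * poly g t" by (subst g(1)) simp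
    then show ?case using elim by auto
  qed
  ultimately have "g \<in> null_on \<gamma> {..<k}" by (simp add: rep_null_iff)
  moreover have "poly.coeff g 0 \<noteq> 0"
    using g(2) by (simp only: poly_eq_0_iff_dvd[symmetric] poly_0_coeff_0) simp
  ultimately show ?thesis
    using \<open>f \<in> null_on \<gamma> {..<k}\<close> \<open>poly.coeff f (k - 1) \<noteq> 0\<close> by blast
qed

text \<open>
  An atom at \<open>0\<close> is invisible to \<open>c\<close>, so minimality of \<open>c\<close> forces \<open>degree c\<close> atoms to avoid \<open>0\<close>.
\<close>

lemma rep_atomic_null:
  assumes atomic: "atomic_measure (degree c) \<mu>"
    and c: "c \<in> null_on \<gamma> {..<k}" "c \<noteq> 0" "poly.coeff c 0 \<noteq> 0"
    and least: "\<And>p. p \<in> null_on \<gamma> {..<k} \<Longrightarrow> p \<noteq> 0 \<Longrightarrow> degree c \<le> degree p"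
  shows "\<exists>p\<in>null_on \<beta> ({..k} - {1}). poly.coeff p 0 \<noteq> 0"
proof -
  from atomic obtain T w where T: "sets \<mu> = sets borel" "finite T" "card T = degree c" "\<forall>t\<in>T. 0 < w t"
    "\<forall>B\<in>sets borel. emeasure \<mu> B = (\<Sum>t\<in>T. ennreal (w t) * emeasure (return borel t) B)"
    by (auto simp: atomic_measure_def)
  have AE: "(AE t in \<mu>. P t) \<longleftrightarrow> (\<forall>t\<in>T. P t)" for P
    using T by (intro AE_atomic_measure) auto
  have deg: "degree c < k" and cT: "\<forall>t\<in>T. t * poly c t = 0"
    using c(1) by (simp_all add: rep_null_iff AE)
  have "0 \<notin> T"
  proof
    assume "0 \<in> T"
    \<comment> \<open>An atom at 0 costs no factor, so the product over the other atoms would be a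
      null polynomial of degree below \<open>degree c\<close>.\<close>
    define h where "h = (\<Prod>t\<in>T - {0}. [:-t, 1:])"
    have "degree h = card (T - {0})"
      unfolding h_def using T(2) by (subst degree_prod_eq_sum_degree) auto
    then have "degree h < degree c" using card_Diff1_less[OF T(2) \<open>0 \<in> T\<close>] T(3) by simp
    moreover have "t * poly h t = 0" if "t \<in> T" for t
      using that T(2) by (auto simp: h_def poly_prod)
    moreover have "h \<noteq> 0" using T(2) by (auto simp: h_def)
    ultimately show False using least[of h] deg by (simp add: rep_null_iff AE)
  qed
  define q where "q = c * [:poly.coeff c 0, - poly.coeff c 1:]"
  have q: "q \<in> polys_on ({..k} - {1})" unfolding q_def using deg by (rule cancel_linear_coeff)
  have "AE t in \<mu>. poly q t = 0"
    unfolding AE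
  proof
    fix t assume "t \<in> T"
    then have "poly c t = 0" using cT \<open>0 \<notin> T\<close> by auto
    then show "poly q t = 0" by (simp add: q_def)
  qed
  then have "q \<in> null_on \<beta> ({..k} - {1})" using rep_square(2)[OF q] q by (auto simp: null_on_def)
  moreover have "poly.coeff q 0 \<noteq> 0" using c(3) by (simp add: q_def)
  ultimately show ?thesis by blast
qed

end

theorem theorem4p1:
  fixes k :: nat and \<beta> :: "nat \<Rightarrow> real"
  assumes k: "k > 1"
    and \<beta>0: "\<beta> 0 > 0"
  shows
    "let
       \<beta>_at = (\<lambda>x\<^sub>0. segment (\<beta>(1 := x\<^sub>0)) 0 (2 * k));
       \<beta>_partial = segment ((\<lambda>i. Some (\<beta> i))(1 := None)) 0 (2 * k);
       \<beta>_hat = segment \<beta> 2 (2 * k - 2);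
       \<beta>_tilde = segment \<beta> 2 (2 * k);
       \<beta>_bar = segment \<beta> 4 (2 * k - 2);
       \<beta>_breve = segment \<beta> 4 (2 * k);
       v = segment \<beta> 2 (k - 1);
       u = segment \<beta> 2 k;
       A_tilde = bordered_mat (\<beta> 0) v (hankel_mat \<beta>_bar);
       A_hat = bordered_mat (\<beta> 0) u (hankel_mat \<beta>_breve);
       stmt1 = (\<exists>x\<^sub>0 \<mu>. representing_measure \<mu> (\<beta>_at x\<^sub>0));
       stmt2 = (\<exists>x\<^sub>0 \<mu>. representing_measure \<mu> (\<beta>_at x\<^sub>0) \<and>
                  (atomic_measure (seq_rank \<beta>_tilde) \<mu> \<or>
                   atomic_measure (seq_rank \<beta>_tilde + 1) \<mu>));
       cond_a = ((k = 2 \<and> pos_def_mat (hankel_mat \<beta>_tilde)) \<or>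
                 (k > 2 \<and> pos_def_mat (hankel_mat \<beta>_tilde) \<and> pos_def_mat A_tilde));
       cond_b = (mat_rank (hankel_mat \<beta>_hat) = mat_rank (hankel_mat \<beta>_tilde) \<and>
                 mat_rank (hankel_mat \<beta>_tilde) = mat_rank (hankel_mat \<beta>_breve));
       stmt3 = (partially_pos_semidef (hankel_mat \<beta>_partial) \<and> (cond_a \<or> cond_b))
     in
       (stmt1 \<longleftrightarrow> stmt2) \<and> (stmt2 \<longleftrightarrow> stmt3) \<and>
       (stmt1 \<longrightarrow>
         ((\<not> (\<exists>x\<^sub>0 \<mu>. representing_measure \<mu> (\<beta>_at x\<^sub>0) \<and> atomic_measure (seq_rank \<beta>_tilde) \<mu>))
          \<longleftrightarrow> cond_b \<and> mat_rank (hankel_mat \<beta>_hat) < mat_rank A_hat))"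
proof -
  define \<gamma> where "\<gamma> = (\<lambda>i. \<beta> (i + 2))"
  have tilde: "hankel_mat (segment \<beta> 2 (2 * k)) = hmat \<gamma> id k"
    using k by (subst hankel_mat_segment[of _ _ k]) (auto simp: hmat_def \<gamma>_def add.commute add.left_commute)
  have hat: "hankel_mat (segment \<beta> 2 (2 * k - 2)) = hmat \<gamma> id (k - 1)"
    using k by (subst hankel_mat_segment[of _ _ "k - 1"]) (auto simp: hmat_def \<gamma>_def add.commute add.left_commute)
  have breve: "hankel_mat (segment \<beta> 4 (2 * k)) = hmat \<beta> (\<lambda>i. i + 2) (k - 1)"
    using k by (subst hankel_mat_segment[of _ _ "k - 1"]) (auto simp: hmat_def intro!: eq_matI arg_cong[of _ _ \<beta>])
  have breve': "hmat \<gamma> Suc (k - 1) = hmat \<beta> (\<lambda>i. i + 2) (k - 1)"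
    by (auto simp: hmat_def \<gamma>_def intro!: eq_matI arg_cong[of _ _ \<beta>])
  have bar: "hankel_mat (segment \<beta> 4 (2 * k - 2)) = hmat \<beta> (\<lambda>i. i + 2) (k - 1 - 1)" if "2 < k"
    using that by (subst hankel_mat_segment[of _ _ "k - 1 - 1"]) (auto simp: hmat_def intro!: eq_matI arg_cong[of _ _ \<beta>])
  have A_tilde: "bordered_mat (\<beta> 0) (segment \<beta> 2 (k - 1)) (hankel_mat (segment \<beta> 4 (2 * k - 2))) = hmat \<beta> skip1 (k - 1)"
    if "2 < k" unfolding bar[OF that] using that by (intro bordered_mat_hmat) simp
  have A_hat: "bordered_mat (\<beta> 0) (segment \<beta> 2 k) (hankel_mat (segment \<beta> 4 (2 * k))) = hmat \<beta> skip1 k"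
    unfolding breve using k by (intro bordered_mat_hmat) simp
  define psd where "psd \<longleftrightarrow> semidefinite_on \<beta> {1..k} \<and> semidefinite_on \<beta> ({..k} - {1})"
  define a where "a \<longleftrightarrow> definite_on \<gamma> {..<k} \<and> definite_on \<beta> ({..<k} - {1})"
  define b where "b \<longleftrightarrow> (\<exists>f\<in>null_on \<gamma> {..<k}. poly.coeff f (k - 1) \<noteq> 0) \<and> (\<exists>f\<in>null_on \<gamma> {..<k}. poly.coeff f 0 \<noteq> 0)"
  \<comment> \<open>When b holds, this says that the deficit at 0 vanishes.\<close>
  define E where "E \<longleftrightarrow> (\<exists>p\<in>null_on \<beta> ({..k} - {1}). poly.coeff p 0 \<noteq> 0)"
  define r where "r = seq_rank (segment \<beta> 2 (2 * k))"
  define R where "R x \<mu> \<longleftrightarrow> representing_measure \<mu> (segment (\<beta>(1 := x)) 0 (2 * k))" for x \<mu>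
  define CA where "CA \<longleftrightarrow> ((k = 2 \<and> pos_def_mat (hankel_mat (segment \<beta> 2 (2 * k)))) \<or>
    (k > 2 \<and> pos_def_mat (hankel_mat (segment \<beta> 2 (2 * k))) \<and>
      pos_def_mat (bordered_mat (\<beta> 0) (segment \<beta> 2 (k - 1)) (hankel_mat (segment \<beta> 4 (2 * k - 2))))))"
  define CB where "CB \<longleftrightarrow>
    mat_rank (hankel_mat (segment \<beta> 2 (2 * k - 2))) = mat_rank (hankel_mat (segment \<beta> 2 (2 * k))) \<and>
    mat_rank (hankel_mat (segment \<beta> 2 (2 * k))) = mat_rank (hankel_mat (segment \<beta> 4 (2 * k)))"
  define RK where "RK \<longleftrightarrow> mat_rank (hankel_mat (segment \<beta> 2 (2 * k - 2))) <
    mat_rank (bordered_mat (\<beta> 0) (segment \<beta> 2 k) (hankel_mat (segment \<beta> 4 (2 * k))))"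
  have part: "partially_pos_semidef (hankel_mat (segment ((\<lambda>i. Some (\<beta> i))(1 := None)) 0 (2 * k))) \<longleftrightarrow> psd"
    unfolding psd_def by (rule partially_pos_semidef_hankel)
  have psd\<gamma>: "semidefinite_on \<gamma> {..<k}" and psd0: "semidefinite_on \<beta> ({..k} - {1})" if psd
    using that unfolding psd_def \<gamma>_def semidefinite_on_shift by auto
  have CA: "CA \<longleftrightarrow> a"
  proof -
    have 1: "pos_def_mat (hmat \<gamma> id k) \<longleftrightarrow> definite_on \<gamma> {..<k}" by (simp add: pos_def_hmat)
    show ?thesis
    proof (cases "k = 2")
      \<comment> \<open>For k = 2 the exponents below k other than 1 reduce to 0, where definiteness
        is the assumption on \<open>\<beta> 0\<close>; this is why (a) then has a single
        condition.\<close>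
      case True
      have set: "{..<k} - {1} = {0}" using True by auto
      have def: "definite_on \<beta> {0}"
        unfolding definite_on_def
      proof (intro ballI impI)
        fix p assume p: "p \<in> polys_on {0}" "p \<noteq> 0"
        obtain x where x: "p = Polynomial.monom x 0"
          using polys_on_expand[OF p(1)] by simp
        then have "x \<noteq> 0" using p(2) by auto
        then have "0 < x\<^sup>2 * \<beta> 0" using \<beta>0 by simp
        then show "0 < mom \<beta> (p * p)" by (simp add: x mult_monom power2_eq_square)
      qed
      have "CA \<longleftrightarrow> definite_on \<gamma> {..<k}"
        unfolding CA_def tilde 1 using True by (simp only: less_irrefl simp_thms)
      then show ?thesis unfolding a_def set using def by (simp only: simp_thms)
    next
      case False
      then have k2: "2 < k" using k by simp
      have "skip1 ` {..<k - 1} = {..<k} - {1}" using k2 skip1_image[of "k - 1"] by auto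
      then have "pos_def_mat (hmat \<beta> skip1 (k - 1)) \<longleftrightarrow> definite_on \<beta> ({..<k} - {1})"
        by (simp add: pos_def_hmat inj_skip1)
      then show ?thesis unfolding CA_def a_def tilde 1 A_tilde[OF k2] using k2 False by (simp only: simp_thms)
    qed
  qed
  have CB: "CB \<longleftrightarrow> b" if psd
  proof -
    \<comment> \<open>Each removal formula has the form n = m or n = Suc m, so equality of the two
      ranks is its condition.\<close>
    have if_Suc: "m = n \<longleftrightarrow> P" "n = m \<longleftrightarrow> P" if "n = (if P then m else Suc m)" for m n P
      using that by auto
    have top: "mat_rank (hmat \<gamma> id k) =
      (if \<exists>p\<in>null_on \<gamma> {..<k}. poly.coeff p (k - 1) \<noteq> 0 then mat_rank (hmat \<gamma> id (k - 1))
       else Suc (mat_rank (hmat \<gamma> id (k - 1))))"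
    proof -
      have "{..<k - 1} = {..<k} - {k - 1}" "k - 1 < k" using k by auto
      then show ?thesis using rank_hmat_remove[of id k \<gamma> id "k - 1" "k - 1"] psd\<gamma>[OF that] by simp
    qed
    have bot: "mat_rank (hmat \<gamma> id k) =
      (if \<exists>p\<in>null_on \<gamma> {..<k}. poly.coeff p 0 \<noteq> 0 then mat_rank (hmat \<gamma> Suc (k - 1))
       else Suc (mat_rank (hmat \<gamma> Suc (k - 1))))"
    proof -
      have "Suc ` {..<k - 1} = {..<k} - {0}"
      proof (intro equalityI subsetI)
        fix i assume "i \<in> {..<k} - {0}"
        then show "i \<in> Suc ` {..<k - 1}" by (intro image_eqI[of _ _ "i - 1"]) auto
      qed auto
      then show ?thesis using rank_hmat_remove[of id k \<gamma> Suc "k - 1" 0] psd\<gamma>[OF that] k by simp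
    qed
    show ?thesis
      unfolding CB_def b_def tilde hat breve breve'[symmetric] if_Suc(1)[OF top] if_Suc(2)[OF bot] ..
  qed
  \<comment> \<open>Removing exponent 0 from 0, 2, ..., \<open>k\<close> leaves the matrix in
    \<open>breve\<close>; \<open>CB\<close> equates its rank with that of the matrix in
    \<open>hat\<close>, the one the statement compares.\<close>
  have RK: "RK \<longleftrightarrow> \<not> E" if psd CB
  proof -
    have "mat_rank (hmat \<beta> skip1 k) =
      (if E then mat_rank (hmat \<beta> (\<lambda>i. i + 2) (k - 1)) else Suc (mat_rank (hmat \<beta> (\<lambda>i. i + 2) (k - 1))))"
    proof -
      have img: "skip1 ` {..<k} = {..k} - {1}" using k by (intro skip1_image) simp
      have img': "(\<lambda>i. i + 2) ` {..<k - 1} = {..k} - {1} - {0}"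
      proof (intro equalityI subsetI)
        fix i assume "i \<in> {..k} - {1} - {0}"
        then show "i \<in> (\<lambda>i. i + 2) ` {..<k - 1}" by (intro image_eqI[of _ _ "i - 2"]) auto
      qed auto
      have inj: "inj_on (\<lambda>i. i + 2) {..<k - 1}" by (simp add: inj_on_def)
      show ?thesis
        unfolding E_def img[symmetric]
        by (rule rank_hmat_remove[OF inj_skip1 _ inj]) (use psd0[OF that(1)] in \<open>auto simp only: img img'\<close>)
    qed
    moreover have "mat_rank (hmat \<gamma> id (k - 1)) = mat_rank (hmat \<beta> (\<lambda>i. i + 2) (k - 1))"
      using that(2) unfolding CB_def tilde hat breve by simp
    ultimately show ?thesis unfolding RK_def hat A_hat by simp
  qed
  have F1: psd and F2: "a \<or> b" if "R x \<mu>" for x \<mu>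
  proof -
    note rep = k that[unfolded R_def] \<gamma>_def
    show psd unfolding psd_def by (intro conjI rep_semidefinite[OF rep]) auto
    show "a \<or> b" unfolding a_def b_def by (rule rep_cases[OF rep])
  qed
  have F3: "\<exists>x \<mu>. R x \<mu> \<and> atomic_measure r \<mu>" if psd a
  proof -
    note psd0 = psd0[OF that(1)]
    have def: "definite_on \<beta> {1..k}" "definite_on \<beta> ({..<k} - {1})"
      using that(2) unfolding a_def \<gamma>_def definite_on_shift by auto
    have "r = k" unfolding r_def using tilde that(2) by (intro seq_rank_definite) (auto simp: a_def)
    obtain x T w where "finite T" "card T = k" "\<And>t. t \<in> T \<Longrightarrow> 0 < w t"
      "\<And>i. i \<le> 2 * k \<Longrightarrow> (\<beta>(1 := x)) i = (\<Sum>t\<in>T. w t * t ^ i)"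
      by (rule representation_definite[OF k psd0 def]) (rule that)
    then show ?thesis
      using atomic_representing_measure_exists[of T w "2 * k" "\<beta>(1 := x)"] unfolding R_def \<open>r = k\<close> by metis
  qed
  \<comment> \<open>With E the construction yields r atoms. Without it there are r + 1, and fewer
    are impossible to achieve with exactly r, since any r-atomic measure forces E.\<close>
  have F45: "(\<exists>x \<mu>. R x \<mu> \<and> atomic_measure (r + (if E then 0 else 1)) \<mu>) \<and>
      (\<forall>x \<mu>. R x \<mu> \<longrightarrow> atomic_measure r \<mu> \<longrightarrow> E)" if hyps: psd b
  proof -
    note psd\<gamma> = psd\<gamma>[OF that(1)] and psd0 = psd0[OF that(1)]
    obtain f g where f: "f \<in> null_on \<gamma> {..<k}" "poly.coeff f (k - 1) \<noteq> 0"
      and g: "g \<in> null_on \<gamma> {..<k}" "poly.coeff g 0 \<noteq> 0" using hyps(2) unfolding b_def by blast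
    have ndef: "\<not> definite_on \<gamma> {..<k}" using definite_null[of \<gamma> "{..<k}" f] f by auto
    have k0: "0 < k" using k by simp
    obtain c where c: "c \<in> null_on \<gamma> {..<k}" "c \<noteq> 0" "degree c = r"
      and least: "\<And>p. p \<in> null_on \<gamma> {..<k} \<Longrightarrow> p \<noteq> 0 \<Longrightarrow> degree c \<le> degree p"
      by (rule seq_rank_least_null[OF tilde k0 psd\<gamma> ndef, folded r_def]) (rule that)
    have c0: "poly.coeff c 0 \<noteq> 0"
      by (rule null_generator(1)[OF k0 psd\<gamma> f g c(1,2) least])
    note sing = representation_singular[OF k _ psd0, folded \<gamma>_def E_def, OF psd\<gamma> f g c(1,2) least]
    obtain x T w where T: "finite T" "\<And>t. t \<in> T \<Longrightarrow> 0 < w t"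
      "\<And>i. i \<le> 2 * k \<Longrightarrow> (\<beta>(1 := x)) i = (\<Sum>t\<in>T. w t * t ^ i)"
      "card T = degree c + (if E then 0 else 1)"
      by (rule sing) (assumption | rule that)+
    have "\<exists>x \<mu>. R x \<mu> \<and> atomic_measure (r + (if E then 0 else 1)) \<mu>"
      using atomic_representing_measure_exists[OF T(1-3)] T(4) c(3) unfolding R_def by metis
    moreover have E if "R x \<mu>" "atomic_measure r \<mu>" for x \<mu>
      unfolding E_def
      using that(2) by (intro rep_atomic_null[OF k that(1)[unfolded R_def] \<gamma>_def _ c(1,2) c0 least]) (simp add: c(3))
    ultimately show ?thesis by blast
  qed
  have F4: "\<exists>x \<mu>. R x \<mu> \<and> atomic_measure r \<mu>" if psd b E
    using F45[OF that(1,2)] that(3) by simp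
  have F4': "\<exists>x \<mu>. R x \<mu> \<and> atomic_measure (r + 1) \<mu>" if psd b "\<not> E"
    using F45[OF that(1,2)] that(3) by simp
  have F5: E if psd b "R x \<mu>" "atomic_measure r \<mu>" for x \<mu>
    using F45[OF that(1,2)] that(3,4) by blast
  have 1: "(\<exists>x \<mu>. R x \<mu>) \<longleftrightarrow> (\<exists>x \<mu>. R x \<mu> \<and> (atomic_measure r \<mu> \<or> atomic_measure (r + 1) \<mu>))"
    using F1 F2 F3 F4 F4' by metis
  have 2: "(\<exists>x \<mu>. R x \<mu> \<and> (atomic_measure r \<mu> \<or> atomic_measure (r + 1) \<mu>)) \<longleftrightarrow> psd \<and> (CA \<or> CB)"
    using F1 F2 F3 F4 F4' CA CB by metis
  \<comment> \<open>Case a always admits r atoms. If none exist, b must hold without E, and there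
    \<open>RK\<close> is the negation of E.\<close>
  have 3: "(\<exists>x \<mu>. R x \<mu>) \<longrightarrow> (\<not> (\<exists>x \<mu>. R x \<mu> \<and> atomic_measure r \<mu>) \<longleftrightarrow> CB \<and> RK)"
    using F1 F2 F3 F4 F5 CB RK by metis
  show ?thesis
    using 1 2 3 unfolding Let_def part[symmetric] R_def r_def CA_def CB_def RK_def by (intro conjI)
qed

end
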